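(* Let $k$ be a fixed positive integer. For any choice of the orthogonal arrays $T_S$, the quantum query complexity of the $k$-orthogonal array problem is $\Omega(n^{k/(k+1)})$ provided that $q\ge n^k$, where the constant behind the $\Omega$ depends on $k$, but not on $n$, $q$, or the choice of the $T_S$. That is, there exist a constant $c_k>0$ and an integer $n_k$, depending only on $k$, such that for every $n\ge n_k$, every $q\ge n^k$ and every family $(T_S)_{S\subseteq[n],|S|=k}$ of orthogonal arrays of length $k$ over $[q]$, the corresponding $k$-orthogonal array function $f\colon[q]^n\to\{0,1\}$ satisfies $Q_2(f)\ge c_k\,n^{k/(k+1)}$.
   Context: $[q]=\{1,\dots,q\}$. A set $T\subseteq[q]^k$ of size $q^{k-1}$ is an orthogonal array of length $k$ iff for every index $i\in[k]$ and all $x_1,\dots,x_{i-1},x_{i+1},\dots,x_k\in[q]$ there exists exactly one $x_i\in[q]$ such that $(x_1,\dots,x_k)\in T$. For $x\in[q]^n$ and $S\subseteq[n]$ with elements $s_1<\dots<s_\ell$, let $x_S=(x_{s_1},\dots,x_{s_\ell})$. Assume each $S\subseteq[n]$ of size $k$ is equipped with an orthogonal array $T_S\subseteq[q]^k$ of length $k$ (arrays for different $S$ may be different). The $k$-orthogonal array problem is the function $f\colon[q]^n\to\{0,1\}$ with $f(x)=1$ iff there exists $S\subseteq[n]$ with $|S|=k$ and $x_S\in T_S$. $Q_2(f)$ denotes the bounded-error quantum query complexity of $f$: the least number of queries made by a quantum query algorithm which on every input $x$ outputs $f(x)$ with probability at least $2/3$. The input $x$ is accessed through the standard oracle which, given an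 index $i$, returns the symbol $x_i$, e.g. $|i\rangle|b\rangle\mapsto|i\rangle|b+x_i \bmod q\rangle$, with arbitrary input-independent unitaries between queries. *)

theory Defs
  imports
    "HOL-Library.FuncSet"
    "HOL-Library.Extended_Nat"
    "HOL-Library.Extended_Real"
    "Jordan_Normal_Form.Schur_Decomposition"
begin

section \<open>Orthogonal arrays\<close>

definition orthogonal_array :: "nat \<Rightarrow> nat \<Rightarrow> nat list set \<Rightarrow> bool" where
  "orthogonal_array k q T \<longleftrightarrow>
     T \<subseteq> {xs. length xs = k \<and> set xs \<subseteq> {1..q}} \<and>
     card T = q ^ (k - 1) \<and>
     (\<forall>us vs. length us + 1 + length vs = k \<and> set us \<subseteq> {1..q} \<and> set vs \<subseteq> {1..q} \<longrightarrow>
        (\<exists>!a. a \<in> {1..q} \<and> us @ a # vs \<in> T))"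

definition inputs :: "nat \<Rightarrow> nat \<Rightarrow> (nat \<Rightarrow> nat) set" where
  "inputs n q = {1..n} \<rightarrow>\<^sub>E {1..q}"

definition restrict_tuple :: "(nat \<Rightarrow> nat) \<Rightarrow> nat set \<Rightarrow> nat list" where
  "restrict_tuple x S = map x (sorted_list_of_set S)"

definition orthogonal_array_problem ::
    "nat \<Rightarrow> nat \<Rightarrow> (nat set \<Rightarrow> nat list set) \<Rightarrow> (nat \<Rightarrow> nat) \<Rightarrow> nat" where
  "orthogonal_array_problem n k T x =
     (if \<exists>S \<subseteq> {1..n}. card S = k \<and> restrict_tuple x S \<in> T S then 1 else 0)"


section \<open>Quantum query algorithms\<close>

text \<open>
  The state space is spanned by the states \<open>|i\<rangle>|b\<rangle>|w\<rangle>\<close>, where the query register \<open>i\<close> ranges over the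
  \<open>n\<close> input positions, the answer register \<open>b\<close> over the integers modulo \<open>q\<close>, and the workspace
  register \<open>w\<close> over \<open>m\<close> values, \<open>m\<close> being chosen by the algorithm. Registers are numbered from 0,
  so the value \<open>i\<close> of the query register stands for the position \<open>i + 1\<close> of the input.
  The state \<open>|i\<rangle>|b\<rangle>|w\<rangle>\<close> is the unit vector with the index \<open>(i * q + b) * m + w\<close>.
\<close>

definition basis_index :: "nat \<Rightarrow> nat \<Rightarrow> nat \<Rightarrow> nat \<Rightarrow> nat \<Rightarrow> nat" where
  "basis_index q m i b w = (i * q + b) * m + w"

definition query_reg :: "nat \<Rightarrow> nat \<Rightarrow> nat \<Rightarrow> nat" where
  "query_reg q m j = j div (q * m)"

definition answer_reg :: "nat \<Rightarrow> nat \<Rightarrow> nat \<Rightarrow> nat" where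
  "answer_reg q m j = (j div m) mod q"

definition work_reg :: "nat \<Rightarrow> nat \<Rightarrow> nat" where
  "work_reg m j = j mod m"

lemma registers_of_basis_index:
  assumes "b < q" "w < m"
  shows "query_reg q m (basis_index q m i b w) = i"
    and "answer_reg q m (basis_index q m i b w) = b"
    and "work_reg m (basis_index q m i b w) = w"
proof -
  have "basis_index q m i b w div m = i * q + b"
    using assms by (simp add: basis_index_def)
  then show "query_reg q m (basis_index q m i b w) = i"
    and "answer_reg q m (basis_index q m i b w) = b"
    using assms by (simp_all add: query_reg_def answer_reg_def div_mult2_eq mult.commute[of q m])
  show "work_reg m (basis_index q m i b w) = w"
    using assms by (simp add: basis_index_def work_reg_def)
qed

lemma basis_index_of_registers:
  "basis_index q m (query_reg q m j) (answer_reg q m j) (work_reg m j) = j"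
  by (simp add: basis_index_def query_reg_def answer_reg_def work_reg_def
      div_mult2_eq mult.commute[of q m])

text \<open>The query operator maps \<open>|i\<rangle>|b\<rangle>|w\<rangle>\<close> to \<open>|i\<rangle>|b + x\<^sub>i mod q\<rangle>|w\<rangle>\<close>; \<open>c\<close> is the source and \<open>r\<close> the target.\<close>

definition query_op :: "nat \<Rightarrow> nat \<Rightarrow> nat \<Rightarrow> (nat \<Rightarrow> nat) \<Rightarrow> complex mat" where
  "query_op n q m x = mat (n * q * m) (n * q * m) (\<lambda>(r, c).
     if r = basis_index q m (query_reg q m c)
              ((answer_reg q m c + x (Suc (query_reg q m c))) mod q) (work_reg m c)
     then 1 else 0)"

definition unitary_mat :: "nat \<Rightarrow> complex mat \<Rightarrow> bool" where
  "unitary_mat d U \<longleftrightarrow> U \<in> carrier_mat d d \<and> mat_adjoint U * U = 1\<^sub>m d \<and> U * mat_adjoint U = 1\<^sub>m d"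

text \<open>The state after \<open>t\<close> queries, including the unitary applied after the last of them.\<close>

primrec query_state ::
    "nat \<Rightarrow> nat \<Rightarrow> nat \<Rightarrow> (nat \<Rightarrow> complex mat) \<Rightarrow> (nat \<Rightarrow> nat) \<Rightarrow> nat \<Rightarrow> complex vec" where
  "query_state n q m U x 0 = U 0 *\<^sub>v unit_vec (n * q * m) 0"
| "query_state n q m U x (Suc t) = U (Suc t) *\<^sub>v (query_op n q m x *\<^sub>v query_state n q m U x t)"

text \<open>
  The final state is measured in the computational basis, and \<open>out\<close> assigns an output to each
  measurement result. Any other two-outcome projective measurement is covered by the choice of the
  last unitary and of \<open>m\<close>.
\<close>

definition output_prob ::
    "nat \<Rightarrow> nat \<Rightarrow> nat \<Rightarrow> (nat \<Rightarrow> complex mat) \<Rightarrow> (nat \<Rightarrow> nat) \<Rightarrow> (nat \<Rightarrow> nat) \<Rightarrow> nat \<Rightarrow> nat \<Rightarrow> real" where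
  "output_prob n q m U out x t v =
     (\<Sum>j | j < n * q * m \<and> out j = v. (cmod (query_state n q m U x t $ j))\<^sup>2)"

definition computable_with_queries ::
    "nat \<Rightarrow> nat \<Rightarrow> ((nat \<Rightarrow> nat) \<Rightarrow> nat) \<Rightarrow> nat \<Rightarrow> bool" where
  "computable_with_queries n q f t \<longleftrightarrow>
     (\<exists>m\<ge>1. \<exists>U out. (\<forall>s\<le>t. unitary_mat (n * q * m) (U s)) \<and>
        (\<forall>x \<in> inputs n q. output_prob n q m U out x t (f x) \<ge> 2 / 3))"

text \<open>
  For \<open>n \<ge> 1\<close> the infimum is over a nonempty set (reading the whole input takes \<open>n\<close> queries), so it
  is the least number of queries. The value \<open>\<infinity>\<close> occurs only for \<open>n = 0\<close>, where the state space has
  dimension 0.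
\<close>

definition Q2 :: "nat \<Rightarrow> nat \<Rightarrow> ((nat \<Rightarrow> nat) \<Rightarrow> nat) \<Rightarrow> enat" where
  "Q2 n q f = Inf {enat t | t. computable_with_queries n q f t}"

end

theory Submission
  imports Defs "HOL-Analysis.L2_Norm" "HOL-Number_Theory.Cong"
begin

text \<open>
  The proof is the adversary method with negative weights, applied to the matrix of Belovs and Spalek.
  Decompose the functions on \<open>[q]\<^sup>n\<close> into orthogonal components indexed by \<open>A \<subseteq> [n]\<close>, the
  projection \<open>E\<^sub>A\<close> being the tensor product of \<open>I - J/q\<close> on the coordinates in \<open>A\<close> and \<open>J/q\<close>
  elsewhere. The block of the adversary matrix belonging to \<open>S\<close> consists of the rows \<open>x\<close> with
  \<open>x\<^sub>S \<in> T\<^sub>S\<close> of a multiple of the sum of \<open>max (t - |A|) 0 E\<^sub>A\<close> over all \<open>A\<close> not containing \<open>S\<close>,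
  where \<open>t = n\<^bsup>k/(k+1)\<^esup>\<close>. Its form at the uniform vectors is of order \<open>t\<close>. On the entries with
  \<open>x\<^sub>i \<noteq> y\<^sub>i\<close> one may replace \<open>E\<^sub>A\<close> with \<open>i \<in> A\<close> by \<open>- E\<^bsub>A - {i}\<^esub>\<close>; the coefficients then telescope to
  at most 1, except when \<open>S - A = {i}\<close>, which happens for so few \<open>S\<close> that
  their contribution is of order \<open>t\<^bsup>k+1\<^esup> / n\<^sup>k = 1\<close>. So the norm drops from order \<open>t\<close> to \<open>O(1)\<close>, and a
  query changes the progress function only by a fraction \<open>O(1/t)\<close> of what the algorithm has to achieve.
\<close>

section \<open>Bilinear forms\<close>

lemma sum_of_bool_mult:
  fixes h :: "'a \<Rightarrow> 'b::semiring_1"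
  assumes "finite C" "u \<in> C"
  shows "(\<Sum>c\<in>C. of_bool (u = c) * h c) = h u"
proof -
  have "(\<Sum>c\<in>C. of_bool (u = c) * h c) = (\<Sum>c\<in>C. if c = u then h c else 0)"
    by (intro sum.cong) auto
  then show ?thesis using assms by simp
qed

definition form :: "'a set \<Rightarrow> 'b set \<Rightarrow> ('a \<Rightarrow> 'b \<Rightarrow> real) \<Rightarrow> ('a \<Rightarrow> complex) \<Rightarrow> ('b \<Rightarrow> complex) \<Rightarrow> complex" where
  "form X Y G f g = (\<Sum>x\<in>X. \<Sum>y\<in>Y. of_real (G x y) * cnj (f x) * g y)"

text \<open>Says that the operator norm of \<open>G\<close>, as a matrix with rows \<open>X\<close>
  and columns \<open>Y\<close>, is at most \<open>B\<close>.\<close>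

definition form_bounded :: "'a set \<Rightarrow> 'b set \<Rightarrow> ('a \<Rightarrow> 'b \<Rightarrow> real) \<Rightarrow> real \<Rightarrow> bool" where
  "form_bounded X Y G B \<longleftrightarrow>
     (\<forall>f g. cmod (form X Y G f g) \<le> B * (L2_set (\<lambda>x. cmod (f x)) X * L2_set (\<lambda>y. cmod (g y)) Y))"

lemma L2_set_square: "(L2_set f A)\<^sup>2 = (\<Sum>a\<in>A. (f a)\<^sup>2)"
  unfolding L2_set_def by (simp add: sum_nonneg)

lemma sum_L2_set_mult_le:
  "(\<Sum>j\<in>J. L2_set (f j) A * L2_set (g j) B)
     \<le> sqrt (\<Sum>j\<in>J. \<Sum>a\<in>A. (f j a)\<^sup>2) * sqrt (\<Sum>j\<in>J. \<Sum>b\<in>B. (g j b)\<^sup>2)"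
  using L2_set_mult_ineq[of "\<lambda>j. L2_set (f j) A" "\<lambda>j. L2_set (g j) B" J]
  by (simp add: L2_set_def sum_nonneg)

text \<open>Passing to vector-valued functions, that is, to \<open>G\<close> tensored with the
  identity, does not raise the norm: the bound holds for each component \<open>j\<close>, and
  Cauchy-Schwarz over \<open>j\<close> collects the components.\<close>

lemma form_bounded_vector:
  assumes "form_bounded X Y G B" "B \<ge> 0"
  shows "cmod (\<Sum>j\<in>J. form X Y G (\<lambda>x. f x j) (\<lambda>y. g y j))
     \<le> B * (sqrt (\<Sum>j\<in>J. \<Sum>x\<in>X. (cmod (f x j))\<^sup>2) * sqrt (\<Sum>j\<in>J. \<Sum>y\<in>Y. (cmod (g y j))\<^sup>2))"
proof -
  have "cmod (\<Sum>j\<in>J. form X Y G (\<lambda>x. f x j) (\<lambda>y. g y j))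
     \<le> (\<Sum>j\<in>J. B * (L2_set (\<lambda>x. cmod (f x j)) X * L2_set (\<lambda>y. cmod (g y j)) Y))"
    by (rule order_trans[OF norm_sum sum_mono]) (use assms in \<open>auto simp: form_bounded_def\<close>)
  also have "\<dots> \<le> B * (sqrt (\<Sum>j\<in>J. \<Sum>x\<in>X. (cmod (f x j))\<^sup>2) * sqrt (\<Sum>j\<in>J. \<Sum>y\<in>Y. (cmod (g y j))\<^sup>2))"
    unfolding sum_distrib_left[symmetric]
    by (rule mult_left_mono[OF sum_L2_set_mult_le]) (use assms in auto)
  finally show ?thesis .
qed

lemma form_scale:
  "form X Y G (\<lambda>x. of_real a * f x) (\<lambda>y. of_real b * g y) = of_real (a * b) * form X Y G f g"
  unfolding form_def by (simp add: sum_distrib_left mult_ac)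

lemma L2_set_cmod_scale:
  "L2_set (\<lambda>x. cmod (of_real a * f x)) X = \<bar>a\<bar> * L2_set (\<lambda>x. cmod (f x)) X"
  by (simp add: L2_set_right_distrib[of "\<bar>a\<bar>"] norm_mult)

lemma cmod_form_le_sum:
  assumes "finite X" "finite Y" "L2_set (\<lambda>x. cmod (f x)) X \<le> 1" "L2_set (\<lambda>y. cmod (g y)) Y \<le> 1"
  shows "cmod (form X Y G f g) \<le> (\<Sum>x\<in>X. \<Sum>y\<in>Y. \<bar>G x y\<bar>)"
  unfolding form_def
proof (intro sum_norm_le)
  fix x y assume "x \<in> X" "y \<in> Y"
  then have "cmod (f x) \<le> 1" "cmod (g y) \<le> 1"
    using assms member_le_L2_set[of X x "\<lambda>x. cmod (f x)"] member_le_L2_set[of Y y "\<lambda>y. cmod (g y)"] by auto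
  then have "cmod (f x) * cmod (g y) \<le> 1" by (simp add: mult_le_one)
  then show "cmod (complex_of_real (G x y) * cnj (f x) * g y) \<le> \<bar>G x y\<bar>"
    by (simp add: norm_mult mult.assoc mult_left_le)
qed

text \<open>Near-maximising unit vectors replace principal singular vectors, so that no spectral theory is needed.\<close>

lemma near_maximiser:
  assumes "finite X" "finite Y" "cmod (form X Y G f0 g0) \<ge> M" "M > 0"
    "L2_set (\<lambda>x. cmod (f0 x)) X \<le> 1" "L2_set (\<lambda>y. cmod (g0 y)) Y \<le> 1"
  obtains N f g where "N \<ge> M" "form_bounded X Y G N"
    "L2_set (\<lambda>x. cmod (f x)) X \<le> 1" "L2_set (\<lambda>y. cmod (g y)) Y \<le> 1"
    "cmod (form X Y G f g) \<ge> 99 / 100 * N"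
proof -
  define V where "V = {cmod (form X Y G f g) | f g. L2_set (\<lambda>x. cmod (f x)) X \<le> 1 \<and> L2_set (\<lambda>y. cmod (g y)) Y \<le> 1}"
  define N where "N = Sup V"
  have bdd: "bdd_above V"
    by (rule bdd_aboveI[of _ "\<Sum>x\<in>X. \<Sum>y\<in>Y. \<bar>G x y\<bar>"]) (use assms cmod_form_le_sum in \<open>auto simp: V_def\<close>)
  have V0: "cmod (form X Y G f0 g0) \<in> V" using assms unfolding V_def by blast
  have NM: "N \<ge> M" using cSup_upper[OF V0 bdd] assms(3) unfolding N_def by linarith
  then have "99/100 * N < Sup V" using assms(4) N_def by simp
  then obtain w where "w \<in> V" "99/100 * N < w"
    using less_cSupD[of V] V0 by blast
  then obtain f g where fg: "L2_set (\<lambda>x. cmod (f x)) X \<le> 1" "L2_set (\<lambda>y. cmod (g y)) Y \<le> 1"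
    "cmod (form X Y G f g) \<ge> 99 / 100 * N" unfolding V_def by force
  have "form_bounded X Y G N"
    unfolding form_bounded_def
  proof (intro allI)
    fix f :: "'a \<Rightarrow> complex" and g :: "'b \<Rightarrow> complex"
    define a where "a = L2_set (\<lambda>x. cmod (f x)) X"
    define b where "b = L2_set (\<lambda>y. cmod (g y)) Y"
    have ab: "a \<ge> 0" "b \<ge> 0" by (simp_all add: a_def b_def)
    show "cmod (form X Y G f g) \<le> N * (L2_set (\<lambda>x. cmod (f x)) X * L2_set (\<lambda>y. cmod (g y)) Y)"
    \<comment> \<open>Scaling to unit vectors needs nonzero norms; if a norm is 0, then
      \<open>f\<close> or \<open>g\<close> vanishes on its index set and the form is 0.\<close>
    proof (cases "a = 0 \<or> b = 0")
      case True
      then have "(\<forall>x\<in>X. f x = 0) \<or> (\<forall>y\<in>Y. g y = 0)"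
        using assms(1,2) by (auto simp: a_def b_def L2_set_eq_0_iff)
      then have "form X Y G f g = 0" unfolding form_def by (auto intro!: sum.neutral)
      then show ?thesis using NM assms(4) ab by (simp add: a_def b_def)
    next
      case False
      then have pos: "a > 0" "b > 0" using ab by auto
      have "cmod (form X Y G (\<lambda>x. of_real (1/a) * f x) (\<lambda>y. of_real (1/b) * g y)) \<in> V"
        unfolding V_def mem_Collect_eq
        by (intro exI conjI, rule refl)
           (use pos in \<open>simp_all only: L2_set_cmod_scale a_def[symmetric] b_def[symmetric], simp_all\<close>)
      then have "cmod (form X Y G (\<lambda>x. of_real (1/a) * f x) (\<lambda>y. of_real (1/b) * g y)) \<le> N"
        unfolding N_def by (rule cSup_upper[OF _ bdd])
      then have "cmod (form X Y G f g) / (a * b) \<le> N"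
        unfolding form_scale norm_mult norm_of_real using pos by (simp add: field_simps)
      then show ?thesis using pos by (simp add: divide_le_eq a_def b_def)
    qed
  qed
  then show ?thesis using that NM fg by blast
qed

text \<open>The entries with equal labels form a block-diagonal part of \<open>G\<close>, whose norm
  is again at most \<open>B\<close>; subtracting it costs a factor 2 by the triangle
  inequality.\<close>

lemma form_bounded_differ:
  assumes fin: "finite X" "finite Y" and G: "form_bounded X Y G B" and B: "B \<ge> 0"
  shows "form_bounded X Y (\<lambda>x y. if c x \<noteq> c' y then G x y else 0) (2 * B)"
  unfolding form_bounded_def
proof (intro allI)
  fix f :: "'a \<Rightarrow> complex" and g :: "'b \<Rightarrow> complex"
  let ?L = "c ` X"
  \<comment> \<open>Splitting \<open>f\<close> and \<open>g\<close> by label turns the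
    block-diagonal part into a vector-valued form. Columns whose label no row carries do not occur
    in that part.\<close>
  define F where "F = (\<lambda>x a. of_bool (c x = a) * f x)"
  define H where "H = (\<lambda>y a. of_bool (c' y = a) * g y)"
  have fL: "finite ?L" using fin by simp
  have eq: "form X Y (\<lambda>x y. if c x \<noteq> c' y then G x y else 0) f g =
      form X Y G f g - (\<Sum>a\<in>?L. form X Y G (\<lambda>x. F x a) (\<lambda>y. H y a))"
  proof -
    have "(\<Sum>a\<in>?L. form X Y G (\<lambda>x. F x a) (\<lambda>y. H y a)) =
       (\<Sum>x\<in>X. \<Sum>y\<in>Y. \<Sum>a\<in>?L. of_real (G x y) * cnj (F x a) * H y a)"
      unfolding form_def by (subst sum.swap) (intro sum.cong refl sum.swap)
    also have "\<dots> = (\<Sum>x\<in>X. \<Sum>y\<in>Y. of_bool (c x = c' y) * (of_real (G x y) * cnj (f x) * g y))"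
    proof (intro sum.cong refl)
      fix x y assume "x \<in> X" "y \<in> Y"
      have "(\<Sum>a\<in>?L. of_real (G x y) * cnj (F x a) * H y a) =
          (\<Sum>a\<in>?L. of_bool (c x = a) * (of_bool (c' y = a) * (of_real (G x y) * cnj (f x) * g y)))"
        by (intro sum.cong refl) (auto simp: F_def H_def)
      also have "\<dots> = of_bool (c' y = c x) * (of_real (G x y) * cnj (f x) * g y)"
        by (rule sum_of_bool_mult) (use fL \<open>x \<in> X\<close> in auto)
      finally show "(\<Sum>a\<in>?L. of_real (G x y) * cnj (F x a) * H y a) =
          of_bool (c x = c' y) * (of_real (G x y) * cnj (f x) * g y)" by (cases "c x = c' y") auto
    qed
    finally have eq_part: "(\<Sum>a\<in>?L. form X Y G (\<lambda>x. F x a) (\<lambda>y. H y a)) =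
        (\<Sum>x\<in>X. \<Sum>y\<in>Y. of_bool (c x = c' y) * (of_real (G x y) * cnj (f x) * g y))" .
    have "form X Y (\<lambda>x y. if c x \<noteq> c' y then G x y else 0) f g = (\<Sum>x\<in>X. \<Sum>y\<in>Y.
        of_real (G x y) * cnj (f x) * g y - of_bool (c x = c' y) * (of_real (G x y) * cnj (f x) * g y))"
      unfolding form_def by (intro sum.cong refl) auto
    then show ?thesis unfolding eq_part by (simp only: form_def sum_subtractf)
  qed
  have sq: "(\<Sum>a\<in>?L. \<Sum>x\<in>Z. (cmod (of_bool (d x = a) * h x))\<^sup>2) \<le> (\<Sum>x\<in>Z. (cmod (h x))\<^sup>2)"
    for Z :: "'z set" and d h
  proof -
    have "(\<Sum>a\<in>?L. \<Sum>x\<in>Z. (cmod (of_bool (d x = a) * h x))\<^sup>2) =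
        (\<Sum>x\<in>Z. \<Sum>a\<in>?L. if a = d x then (cmod (h x))\<^sup>2 else 0)"
      by (subst sum.swap) (intro sum.cong refl, auto)
    also have "\<dots> \<le> (\<Sum>x\<in>Z. (cmod (h x))\<^sup>2)"
      by (intro sum_mono) (use fL in auto)
    finally show ?thesis .
  qed
  have "cmod (\<Sum>a\<in>?L. form X Y G (\<lambda>x. F x a) (\<lambda>y. H y a)) \<le>
      B * (sqrt (\<Sum>a\<in>?L. \<Sum>x\<in>X. (cmod (F x a))\<^sup>2) * sqrt (\<Sum>a\<in>?L. \<Sum>y\<in>Y. (cmod (H y a))\<^sup>2))"
    by (rule form_bounded_vector[OF G B])
  also have "\<dots> \<le> B * (L2_set (\<lambda>x. cmod (f x)) X * L2_set (\<lambda>y. cmod (g y)) Y)"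
    unfolding L2_set_def F_def H_def
    by (intro mult_left_mono mult_mono real_sqrt_le_mono sq B) (auto intro!: sum_nonneg)
  finally have 1: "cmod (\<Sum>a\<in>?L. form X Y G (\<lambda>x. F x a) (\<lambda>y. H y a)) \<le>
      B * (L2_set (\<lambda>x. cmod (f x)) X * L2_set (\<lambda>y. cmod (g y)) Y)" .
  have 2: "cmod (form X Y G f g) \<le> B * (L2_set (\<lambda>x. cmod (f x)) X * L2_set (\<lambda>y. cmod (g y)) Y)"
    using G unfolding form_bounded_def by blast
  show "cmod (form X Y (\<lambda>x y. if c x \<noteq> c' y then G x y else 0) f g) \<le>
      2 * B * (L2_set (\<lambda>x. cmod (f x)) X * L2_set (\<lambda>y. cmod (g y)) Y)"
    unfolding eq by (rule order_trans[OF norm_triangle_ineq4]) (use 1 2 in linarith)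
qed

lemma cmod_sum_square_le:
  "(cmod (\<Sum>s\<in>S. h s))\<^sup>2 \<le> real (card S) * (\<Sum>s\<in>S. (cmod (h s))\<^sup>2)"
proof -
  have "cmod (\<Sum>s\<in>S. h s) \<le> (\<Sum>s\<in>S. \<bar>cmod (h s)\<bar> * \<bar>1\<bar>)"
    using norm_sum[of h S] by simp
  also have "\<dots> \<le> L2_set (\<lambda>s. cmod (h s)) S * L2_set (\<lambda>_. 1) S"
    by (rule L2_set_mult_ineq)
  finally have "(cmod (\<Sum>s\<in>S. h s))\<^sup>2 \<le> (L2_set (\<lambda>s. cmod (h s)) S * L2_set (\<lambda>_. 1) S)\<^sup>2"
    by (intro power_mono) auto
  then show ?thesis by (simp add: power_mult_distrib L2_set_square mult.commute)
qed

section \<open>The adversary bound\<close>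

lemma mat_adjoint_index:
  assumes "U \<in> carrier_mat d d" "a < d" "r < d"
  shows "mat_adjoint U $$ (a, r) = cnj (U $$ (r, a))"
  using assms unfolding mat_adjoint_def by (auto simp: mat_of_rows_index conjugate_vec_def)

lemma unitary_inner:
  assumes U: "unitary_mat d U" and v: "v \<in> carrier_vec d" "w \<in> carrier_vec d"
  shows "(\<Sum>j<d. cnj ((U *\<^sub>v v) $ j) * (U *\<^sub>v w) $ j) = (\<Sum>j<d. cnj (v $ j) * w $ j)"
proof -
  have Uc: "U \<in> carrier_mat d d" and UU: "mat_adjoint U * U = 1\<^sub>m d"
    using U unfolding unitary_mat_def by auto
  have Ad: "mat_adjoint U \<in> carrier_mat d d"
    using Uc unfolding mat_adjoint_def by auto
  have cols: "(\<Sum>r<d. cnj (U $$ (r, a)) * U $$ (r, b)) = of_bool (a = b)" if "a < d" "b < d" for a b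
  proof -
    have "(\<Sum>r<d. cnj (U $$ (r, a)) * U $$ (r, b)) = (mat_adjoint U * U) $$ (a, b)"
      using that Uc Ad mat_adjoint_index[OF Uc]
      by (auto simp: scalar_prod_def lessThan_atLeast0 intro!: sum.cong)
    then show ?thesis using that unfolding UU by simp
  qed
  have app: "(U *\<^sub>v z) $ j = (\<Sum>a<d. U $$ (j, a) * z $ a)" if "j < d" "z \<in> carrier_vec d" for j z
    using that Uc by (auto simp: scalar_prod_def lessThan_atLeast0)
  have "(\<Sum>j<d. cnj ((U *\<^sub>v v) $ j) * (U *\<^sub>v w) $ j) =
      (\<Sum>j<d. \<Sum>a<d. \<Sum>b<d. (cnj (v $ a) * w $ b) * (cnj (U $$ (j, a)) * U $$ (j, b)))"
  proof (intro sum.cong refl)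
    fix j assume "j \<in> {..<d}"
    then have j: "j < d" by simp
    show "cnj ((U *\<^sub>v v) $ j) * (U *\<^sub>v w) $ j =
        (\<Sum>a<d. \<Sum>b<d. (cnj (v $ a) * w $ b) * (cnj (U $$ (j, a)) * U $$ (j, b)))"
      unfolding app[OF j v(1)] app[OF j v(2)] cnj_sum sum_product
      by (intro sum.cong refl) (simp add: mult_ac)
  qed
  also have "\<dots> = (\<Sum>a<d. \<Sum>b<d. \<Sum>j<d. (cnj (v $ a) * w $ b) * (cnj (U $$ (j, a)) * U $$ (j, b)))"
    by (subst sum.swap) (intro sum.cong refl sum.swap)
  also have "\<dots> = (\<Sum>a<d. \<Sum>b<d. of_bool (a = b) * (cnj (v $ a) * w $ b))"
    unfolding sum_distrib_left[symmetric] by (intro sum.cong refl) (simp add: cols)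
  also have "\<dots> = (\<Sum>a<d. cnj (v $ a) * w $ a)"
    by (intro sum.cong refl sum_of_bool_mult) auto
  finally show ?thesis .
qed

section \<open>Query algorithms: inner products and norms of the states\<close>

locale query_algorithm =
  fixes n q m :: nat and U :: "nat \<Rightarrow> complex mat" and t :: nat
  assumes n0: "0 < n" and q0: "0 < q" and m0: "0 < m"
    and unitary: "s \<le> t \<Longrightarrow> unitary_mat (n * q * m) (U s)"
begin

abbreviation "state_dim \<equiv> n * q * m"
abbreviation "reg \<equiv> query_reg q m"
abbreviation "state x s \<equiv> query_state n q m U x s"
abbreviation "queried x s \<equiv> query_op n q m x *\<^sub>v query_state n q m U x s"

definition block :: "nat \<Rightarrow> nat set" where
  "block i = {j \<in> {..<state_dim}. reg j = i}"

text \<open>The query operator is a permutation matrix, and this is the permutation. It keeps the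
  query register, so it acts within each \<open>block\<close>.\<close>

definition target :: "(nat \<Rightarrow> nat) \<Rightarrow> nat \<Rightarrow> nat" where
  "target x c = basis_index q m (reg c) ((answer_reg q m c + x (Suc (reg c))) mod q) (work_reg m c)"

lemma reg_less: "j < state_dim \<Longrightarrow> reg j < n"
  unfolding query_reg_def by (simp add: less_mult_imp_div_less mult.assoc)

lemma sum_blocks: "(\<Sum>j<state_dim. h j) = (\<Sum>i<n. \<Sum>j\<in>block i. h j)"
  unfolding block_def by (rule sum.group[symmetric]) (auto intro: reg_less)

lemma target_regs:
  "reg (target x c) = reg c"
  "answer_reg q m (target x c) = (answer_reg q m c + x (Suc (reg c))) mod q"
  "work_reg m (target x c) = work_reg m c"
proof -
  have "work_reg m c < m" using m0 by (simp add: work_reg_def)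
  then show "reg (target x c) = reg c"
    "answer_reg q m (target x c) = (answer_reg q m c + x (Suc (reg c))) mod q"
    "work_reg m (target x c) = work_reg m c"
    unfolding target_def using q0 by (simp_all add: registers_of_basis_index)
qed

lemma basis_index_less:
  assumes "i < n" "b < q" "w < m"
  shows "basis_index q m i b w < state_dim"
proof -
  have "Suc i * q \<le> n * q" using assms(1) by (intro mult_le_mono1) simp
  then have "i * q + b < n * q" using assms(2) by simp
  then have "Suc (i * q + b) * m \<le> n * q * m" by (intro mult_le_mono1) simp
  then show ?thesis using assms(3) by (simp add: basis_index_def)
qed

lemma target_less: "c < state_dim \<Longrightarrow> target x c < state_dim"
  unfolding target_def using reg_less q0 m0 by (intro basis_index_less) (auto simp: work_reg_def)

lemma target_inj: "target x c = target x c' \<Longrightarrow> c = c'"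
proof -
  assume eq: "target x c = target x c'"
  have r: "reg c = reg c'" using arg_cong[OF eq, of reg] by (simp add: target_regs)
  have w: "work_reg m c = work_reg m c'" using arg_cong[OF eq, of "work_reg m"] by (simp add: target_regs)
  \<comment> \<open>The common input symbol cancels modulo \<open>q\<close>, and the answer
    registers are already reduced modulo \<open>q\<close>.\<close>
  have "[answer_reg q m c + x (Suc (reg c)) = answer_reg q m c' + x (Suc (reg c))] (mod q)"
    using arg_cong[OF eq, of "answer_reg q m"] r by (simp add: target_regs cong_def)
  then have "[answer_reg q m c = answer_reg q m c'] (mod q)"
    by (simp add: cong_add_rcancel_nat)
  then have "answer_reg q m c = answer_reg q m c'"
    by (simp add: cong_def answer_reg_def)
  then show "c = c'" using r w basis_index_of_registers by metis
qed

lemma bij_target: "bij_betw (target x) (block i) (block i)"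
proof -
  have inj: "inj_on (target x) (block i)" by (auto intro: inj_onI target_inj)
  have "target x ` block i \<subseteq> block i" by (auto simp: block_def target_regs target_less)
  then have "target x ` block i = block i"
    using inj by (intro endo_inj_surj) (auto simp: block_def)
  then show ?thesis using inj by (simp add: bij_betw_def)
qed

lemma query_op_target:
  assumes "\<phi> \<in> carrier_vec state_dim" "c < state_dim"
  shows "(query_op n q m x *\<^sub>v \<phi>) $ target x c = \<phi> $ c"
proof -
  have "(query_op n q m x *\<^sub>v \<phi>) $ target x c =
      (\<Sum>c'<state_dim. (if target x c = target x c' then 1 else 0) * \<phi> $ c')"
    using assms target_less[OF assms(2), of x]
    by (auto simp: query_op_def scalar_prod_def lessThan_atLeast0 target_def[symmetric] intro!: sum.cong)
  also have "\<dots> = (\<Sum>c'<state_dim. if c' = c then \<phi> $ c' else 0)"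
    by (intro sum.cong refl) (auto dest: target_inj)
  finally show ?thesis using assms(2) by simp
qed

text \<open>On \<open>block i\<close> both query operators are the same permutation as soon as the
  inputs agree at position \<open>Suc i\<close>. Hence a query changes an inner product only through
  blocks whose position separates the two inputs.\<close>

lemma query_op_block_inner:
  assumes "\<phi> \<in> carrier_vec state_dim" "\<psi> \<in> carrier_vec state_dim" "x (Suc i) = y (Suc i)"
  shows "(\<Sum>j\<in>block i. cnj ((query_op n q m x *\<^sub>v \<phi>) $ j) * (query_op n q m y *\<^sub>v \<psi>) $ j) =
     (\<Sum>j\<in>block i. cnj (\<phi> $ j) * \<psi> $ j)"
proof -
  have "(\<Sum>j\<in>block i. cnj ((query_op n q m x *\<^sub>v \<phi>) $ j) * (query_op n q m y *\<^sub>v \<psi>) $ j) =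
      (\<Sum>c\<in>block i. cnj ((query_op n q m x *\<^sub>v \<phi>) $ target x c) * (query_op n q m y *\<^sub>v \<psi>) $ target x c)"
    by (rule sum.reindex_bij_betw[OF bij_target, symmetric])
  also have "\<dots> = (\<Sum>j\<in>block i. cnj (\<phi> $ j) * \<psi> $ j)"
  proof (intro sum.cong refl)
    fix c assume c: "c \<in> block i"
    then have "target x c = target y c" using assms(3) by (simp add: target_def block_def)
    then show "cnj ((query_op n q m x *\<^sub>v \<phi>) $ target x c) * (query_op n q m y *\<^sub>v \<psi>) $ target x c = cnj (\<phi> $ c) * \<psi> $ c"
      using query_op_target[OF assms(1), of c x] query_op_target[OF assms(2), of c y] c
      by (simp add: block_def)
  qed
  finally show ?thesis .
qed

lemma query_op_carrier: "query_op n q m x \<in> carrier_mat state_dim state_dim"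
  by (simp add: query_op_def)

lemma state_carrier: "s \<le> t \<Longrightarrow> state x s \<in> carrier_vec state_dim"
proof (induction s)
  case 0
  then show ?case using unitary[of 0] by (auto simp: unitary_mat_def)
next
  case (Suc s)
  have "query_op n q m x *\<^sub>v state x s \<in> carrier_vec state_dim"
    by (rule mult_mat_vec_carrier[OF query_op_carrier Suc.IH]) (use Suc.prems in auto)
  moreover have "U (Suc s) \<in> carrier_mat state_dim state_dim"
    using unitary[OF Suc.prems] by (simp add: unitary_mat_def)
  ultimately show ?case
    unfolding query_state.simps by (intro mult_mat_vec_carrier[of "U (Suc s)"])
qed

lemma queried_carrier: "s \<le> t \<Longrightarrow> queried x s \<in> carrier_vec state_dim"
  by (rule mult_mat_vec_carrier[OF query_op_carrier state_carrier])

lemma state_0_inner: "(\<Sum>j<state_dim. cnj (state x 0 $ j) * state y 0 $ j) = 1"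
proof -
  have d: "0 < state_dim" using n0 q0 m0 by simp
  have "(\<Sum>j<state_dim. cnj (state x 0 $ j) * state y 0 $ j) =
      (\<Sum>j<state_dim. cnj (unit_vec state_dim 0 $ j) * unit_vec state_dim 0 $ j :: complex)"
    unfolding query_state.simps by (rule unitary_inner) (use unitary[of 0] in auto)
  also have "\<dots> = (\<Sum>j<state_dim. if j = 0 then 1 else 0)"
    by (intro sum.cong refl) (auto simp: unit_vec_def)
  finally show ?thesis using d by simp
qed

lemma state_Suc_inner:
  assumes "Suc s \<le> t"
  shows "(\<Sum>j<state_dim. cnj (state x (Suc s) $ j) * state y (Suc s) $ j) = (\<Sum>j<state_dim. cnj (queried x s $ j) * queried y s $ j)"
  unfolding query_state.simps by (rule unitary_inner) (use unitary assms queried_carrier in auto)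

lemma queried_inner:
  assumes "s \<le> t"
  shows "(\<Sum>j<state_dim. cnj (queried x s $ j) * queried x s $ j) = (\<Sum>j<state_dim. cnj (state x s $ j) * state x s $ j)"
  unfolding sum_blocks by (intro sum.cong refl query_op_block_inner state_carrier assms)

lemma sum_norm_square: "complex_of_real (\<Sum>j\<in>J. (cmod (\<phi> j))\<^sup>2) = (\<Sum>j\<in>J. cnj (\<phi> j) * \<phi> j)"
  unfolding of_real_sum complex_norm_square by (simp only: mult.commute)

lemma state_norm: "s \<le> t \<Longrightarrow> (\<Sum>j<state_dim. (cmod (state x s $ j))\<^sup>2) = 1"
proof -
  assume "s \<le> t"
  then have "(\<Sum>j<state_dim. cnj (state x s $ j) * state x s $ j) = 1"
    by (induction s) (simp_all only: state_0_inner state_Suc_inner queried_inner Suc_leD)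
  then have "complex_of_real (\<Sum>j<state_dim. (cmod (state x s $ j))\<^sup>2) = of_real 1"
    unfolding sum_norm_square by simp
  then show ?thesis unfolding of_real_eq_iff .
qed

lemma queried_norm: "s \<le> t \<Longrightarrow> (\<Sum>j<state_dim. (cmod (queried x s $ j))\<^sup>2) = 1"
proof -
  assume s: "s \<le> t"
  have "complex_of_real (\<Sum>j<state_dim. (cmod (queried x s $ j))\<^sup>2) = of_real (\<Sum>j<state_dim. (cmod (state x s $ j))\<^sup>2)"
    unfolding sum_norm_square by (rule queried_inner[OF s])
  then show ?thesis unfolding of_real_eq_iff by (simp only: state_norm[OF s])
qed

end

section \<open>The progress function and its change under queries\<close>

lemma weighted_mass:
  assumes "\<And>x. x \<in> X \<Longrightarrow> (\<Sum>j\<in>J. (cmod (\<Phi> x j))\<^sup>2) \<le> c" "L2_set (\<lambda>x. cmod (u x)) X \<le> 1" "c \<ge> 0"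
  shows "(\<Sum>j\<in>J. \<Sum>x\<in>X. (cmod (u x * \<Phi> x j))\<^sup>2) \<le> c"
proof -
  have "(\<Sum>j\<in>J. \<Sum>x\<in>X. (cmod (u x * \<Phi> x j))\<^sup>2) = (\<Sum>x\<in>X. (cmod (u x))\<^sup>2 * (\<Sum>j\<in>J. (cmod (\<Phi> x j))\<^sup>2))"
    by (subst sum.swap) (simp add: norm_mult power_mult_distrib sum_distrib_left)
  also have "\<dots> \<le> (\<Sum>x\<in>X. (cmod (u x))\<^sup>2 * c)"
    by (intro sum_mono mult_left_mono assms) auto
  also have "\<dots> = (L2_set (\<lambda>x. cmod (u x)) X)\<^sup>2 * c"
    by (simp add: L2_set_square sum_distrib_right)
  also have "\<dots> \<le> 1 * c"
    using assms by (intro mult_right_mono) (auto simp: power_le_one)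
  finally show ?thesis by simp
qed

lemma sum_form_vector:
  "(\<Sum>j\<in>J. form X Y G (\<lambda>x. u x * \<Phi> x j) (\<lambda>y. v y * \<Psi> y j)) =
   (\<Sum>x\<in>X. \<Sum>y\<in>Y. of_real (G x y) * cnj (u x) * v y * (\<Sum>j\<in>J. cnj (\<Phi> x j) * \<Psi> y j))"
proof -
  have "(\<Sum>j\<in>J. form X Y G (\<lambda>x. u x * \<Phi> x j) (\<lambda>y. v y * \<Psi> y j)) =
     (\<Sum>x\<in>X. \<Sum>y\<in>Y. \<Sum>j\<in>J. of_real (G x y) * cnj (u x * \<Phi> x j) * (v y * \<Psi> y j))"
    unfolding form_def by (subst sum.swap) (intro sum.cong refl sum.swap)
  then show ?thesis by (simp add: sum_distrib_left mult_ac)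
qed

context query_algorithm
begin

text \<open>The masses of the vectors in the individual blocks sum to at most 1, so AM-GM applied in
  each block gives \<open>D\<close> in total, without a factor \<open>n\<close>.\<close>

lemma sum_block_forms_le:
  assumes G: "\<And>i. i < n \<Longrightarrow> form_bounded X Y (G i) D" and D: "D \<ge> 0"
    and u: "L2_set (\<lambda>x. cmod (u x)) X \<le> 1" and v: "L2_set (\<lambda>y. cmod (v y)) Y \<le> 1"
    and \<Phi>: "\<And>x. x \<in> X \<Longrightarrow> (\<Sum>j<state_dim. (cmod (\<Phi> x j))\<^sup>2) \<le> 1"
    and \<Psi>: "\<And>y. y \<in> Y \<Longrightarrow> (\<Sum>j<state_dim. (cmod (\<Psi> y j))\<^sup>2) \<le> 1"
  shows "cmod (\<Sum>i<n. \<Sum>j\<in>block i. form X Y (G i) (\<lambda>x. u x * \<Phi> x j) (\<lambda>y. v y * \<Psi> y j)) \<le> D"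
proof -
  define a where "a = (\<lambda>i. \<Sum>j\<in>block i. \<Sum>x\<in>X. (cmod (u x * \<Phi> x j))\<^sup>2)"
  define b where "b = (\<lambda>i. \<Sum>j\<in>block i. \<Sum>y\<in>Y. (cmod (v y * \<Psi> y j))\<^sup>2)"
  have ab: "(\<Sum>i<n. a i) \<le> 1" "(\<Sum>i<n. b i) \<le> 1"
    unfolding a_def b_def sum_blocks[symmetric]
    using weighted_mass[of X \<Phi> "{..<state_dim}" 1 u] weighted_mass[of Y \<Psi> "{..<state_dim}" 1 v] \<Phi> \<Psi> u v by auto
  have nn: "a i \<ge> 0" "b i \<ge> 0" for i by (simp_all add: a_def b_def sum_nonneg)
  have "cmod (\<Sum>i<n. \<Sum>j\<in>block i. form X Y (G i) (\<lambda>x. u x * \<Phi> x j) (\<lambda>y. v y * \<Psi> y j)) \<le>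
      (\<Sum>i<n. D * (sqrt (a i) * sqrt (b i)))"
    unfolding a_def b_def by (intro order_trans[OF norm_sum] sum_mono form_bounded_vector G D) auto
  also have "\<dots> \<le> (\<Sum>i<n. D * ((a i + b i) / 2))"
  proof (intro sum_mono mult_left_mono D)
    fix i
    show "sqrt (a i) * sqrt (b i) \<le> (a i + b i) / 2"
      using arith_geo_mean_sqrt[of "a i" "b i"] nn by (simp add: real_sqrt_mult)
  qed
  also have "\<dots> = D * (((\<Sum>i<n. a i) + (\<Sum>i<n. b i)) / 2)"
    by (simp add: sum_distrib_left[symmetric] sum_divide_distrib[symmetric] sum.distrib)
  also have "\<dots> \<le> D * 1" using ab by (intro mult_left_mono D) simp
  finally show ?thesis by simp
qed

text \<open>Inner products of the states on the inputs \<open>p x\<close> and \<open>y\<close>,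
  weighted by \<open>G\<close>, \<open>u\<close> and \<open>v\<close>. The map \<open>p\<close>
  sends a row label to its input, so that several rows may share one input.\<close>

definition progress where
  "progress X Y G p u v s = (\<Sum>j<state_dim. form X Y G (\<lambda>x. u x * state (p x) s $ j) (\<lambda>y. v y * state y s $ j))"

lemma progress_0: "progress X Y G p u v 0 = form X Y G u v"
  unfolding progress_def sum_form_vector state_0_inner by (simp add: form_def)

text \<open>In \<open>block i\<close> the entries with \<open>p x\<close> and \<open>y\<close> equal
  at position \<open>Suc i\<close> contribute the same before and after the query, so
  \<open>G\<close> may be replaced there by its separating part. That part contributes at most
  \<open>D\<close> before and at most \<open>D\<close> after the query; the unitary that follows
  preserves inner products.\<close>

lemma progress_step:
  assumes s: "Suc s \<le> t"
    and G: "\<And>i. i \<in> {1..n} \<Longrightarrow> form_bounded X Y (\<lambda>x y. if p x i \<noteq> y i then G x y else 0) D" and D: "D \<ge> 0"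
    and u: "L2_set (\<lambda>x. cmod (u x)) X \<le> 1" and v: "L2_set (\<lambda>y. cmod (v y)) Y \<le> 1"
  shows "cmod (progress X Y G p u v (Suc s) - progress X Y G p u v s) \<le> 2 * D"
proof -
  let ?G = "\<lambda>i x y. if p x (Suc i) \<noteq> y (Suc i) then G x y else 0"
  have s': "s \<le> t" using s by simp
  have diff: "(\<Sum>j\<in>block i. form X Y G (\<lambda>x. u x * queried (p x) s $ j) (\<lambda>y. v y * queried y s $ j)) -
        (\<Sum>j\<in>block i. form X Y G (\<lambda>x. u x * state (p x) s $ j) (\<lambda>y. v y * state y s $ j)) =
      (\<Sum>j\<in>block i. form X Y (?G i) (\<lambda>x. u x * queried (p x) s $ j) (\<lambda>y. v y * queried y s $ j)) -
        (\<Sum>j\<in>block i. form X Y (?G i) (\<lambda>x. u x * state (p x) s $ j) (\<lambda>y. v y * state y s $ j))" for i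
    unfolding sum_form_vector sum_subtractf[symmetric]
  proof (intro sum.cong refl)
    fix x y
    show "of_real (G x y) * cnj (u x) * v y * (\<Sum>j\<in>block i. cnj (queried (p x) s $ j) * queried y s $ j) -
        of_real (G x y) * cnj (u x) * v y * (\<Sum>j\<in>block i. cnj (state (p x) s $ j) * state y s $ j) =
        of_real (?G i x y) * cnj (u x) * v y * (\<Sum>j\<in>block i. cnj (queried (p x) s $ j) * queried y s $ j) -
        of_real (?G i x y) * cnj (u x) * v y * (\<Sum>j\<in>block i. cnj (state (p x) s $ j) * state y s $ j)"
    proof (cases "p x (Suc i) = y (Suc i)")
      case True
      then show ?thesis
        by (simp only: query_op_block_inner[of "state (p x) s" "state y s" "p x" i y, OF state_carrier[OF s'] state_carrier[OF s'] True]) simp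
    next
      case False
      then show ?thesis by (simp only: if_True simp_thms)
    qed
  qed
  have "progress X Y G p u v (Suc s) =
      (\<Sum>j<state_dim. form X Y G (\<lambda>x. u x * queried (p x) s $ j) (\<lambda>y. v y * queried y s $ j))"
    unfolding progress_def sum_form_vector state_Suc_inner[OF s] ..
  then have "progress X Y G p u v (Suc s) - progress X Y G p u v s =
      (\<Sum>i<n. \<Sum>j\<in>block i. form X Y G (\<lambda>x. u x * queried (p x) s $ j) (\<lambda>y. v y * queried y s $ j)) -
      (\<Sum>i<n. \<Sum>j\<in>block i. form X Y G (\<lambda>x. u x * state (p x) s $ j) (\<lambda>y. v y * state y s $ j))"
    by (simp only: progress_def sum_blocks)
  also have "\<dots> =
      (\<Sum>i<n. \<Sum>j\<in>block i. form X Y (?G i) (\<lambda>x. u x * queried (p x) s $ j) (\<lambda>y. v y * queried y s $ j)) -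
      (\<Sum>i<n. \<Sum>j\<in>block i. form X Y (?G i) (\<lambda>x. u x * state (p x) s $ j) (\<lambda>y. v y * state y s $ j))"
    by (subst (1 2) sum_subtractf[symmetric]) (simp only: diff)
  finally have eq: "progress X Y G p u v (Suc s) - progress X Y G p u v s =
      (\<Sum>i<n. \<Sum>j\<in>block i. form X Y (?G i) (\<lambda>x. u x * queried (p x) s $ j) (\<lambda>y. v y * queried y s $ j)) -
      (\<Sum>i<n. \<Sum>j\<in>block i. form X Y (?G i) (\<lambda>x. u x * state (p x) s $ j) (\<lambda>y. v y * state y s $ j))" .
  have q_le: "cmod (\<Sum>i<n. \<Sum>j\<in>block i. form X Y (?G i) (\<lambda>x. u x * queried (p x) s $ j) (\<lambda>y. v y * queried y s $ j)) \<le> D"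
    by (rule sum_block_forms_le[OF _ D u v]) (use G queried_norm[OF s'] in auto)
  have st_le: "cmod (\<Sum>i<n. \<Sum>j\<in>block i. form X Y (?G i) (\<lambda>x. u x * state (p x) s $ j) (\<lambda>y. v y * state y s $ j)) \<le> D"
    by (rule sum_block_forms_le[OF _ D u v]) (use G state_norm[OF s'] in auto)
  show ?thesis
    unfolding eq by (rule order_trans[OF norm_triangle_ineq4]) (use q_le st_le in linarith)
qed

lemma progress_change:
  assumes "s \<le> t"
    and "\<And>i. i \<in> {1..n} \<Longrightarrow> form_bounded X Y (\<lambda>x y. if p x i \<noteq> y i then G x y else 0) D" and "D \<ge> 0"
    and "L2_set (\<lambda>x. cmod (u x)) X \<le> 1" and "L2_set (\<lambda>y. cmod (v y)) Y \<le> 1"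
  shows "cmod (progress X Y G p u v s - progress X Y G p u v 0) \<le> 2 * real s * D"
  using assms(1)
proof (induction s)
  case (Suc s)
  have "cmod (progress X Y G p u v (Suc s) - progress X Y G p u v 0) \<le>
      cmod (progress X Y G p u v (Suc s) - progress X Y G p u v s) +
      cmod (progress X Y G p u v s - progress X Y G p u v 0)"
    using norm_triangle_ineq[of "progress X Y G p u v (Suc s) - progress X Y G p u v s"
        "progress X Y G p u v s - progress X Y G p u v 0"] by simp
  also have "\<dots> \<le> 2 * D + 2 * real s * D"
    using Suc by (intro add_mono progress_step assms) auto
  finally show ?case by (simp add: algebra_simps)
qed simp

text \<open>
  The weights \<open>7/10\<close> and \<open>10/7\<close> approximate \<open>1/\<surd>2\<close> and \<open>\<surd>2\<close>, for which AM-GM would give the optimal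
  factor \<open>2 \<surd>2 / 3\<close>.
\<close>

lemma progress_final:
  assumes G: "form_bounded X Y G N" and N: "N \<ge> 0"
    and u: "L2_set (\<lambda>x. cmod (u x)) X \<le> 1" and v: "L2_set (\<lambda>y. cmod (v y)) Y \<le> 1"
    and acc: "\<And>x. x \<in> X \<Longrightarrow> output_prob n q m U out (p x) t 1 \<ge> 2 / 3"
    and rej: "\<And>y. y \<in> Y \<Longrightarrow> output_prob n q m U out y t 0 \<ge> 2 / 3"
  shows "cmod (progress X Y G p u v t) \<le> 943 / 1000 * N"
proof -
  \<comment> \<open>Every measurement result with an output other than 1 is counted in
    \<open>R\<close>, also if the output is not 0.\<close>
  define A where "A = {j \<in> {..<state_dim}. out j = 1}"
  define R where "R = {j \<in> {..<state_dim}. out j \<noteq> 1}"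
  have AR: "A \<inter> R = {}" "A \<union> R = {..<state_dim}" "finite A" "finite R" unfolding A_def R_def by auto
  have split: "(\<Sum>j<state_dim. h j) = (\<Sum>j\<in>A. h j) + (\<Sum>j\<in>R. h j)" for h :: "nat \<Rightarrow> 'z :: comm_monoid_add"
    using sum.union_disjoint[OF AR(3,4,1), of h] AR(2) by simp
  define a1 where "a1 = (\<Sum>j\<in>A. \<Sum>x\<in>X. (cmod (u x * state (p x) t $ j))\<^sup>2)"
  define a0 where "a0 = (\<Sum>j\<in>R. \<Sum>x\<in>X. (cmod (u x * state (p x) t $ j))\<^sup>2)"
  define b1 where "b1 = (\<Sum>j\<in>A. \<Sum>y\<in>Y. (cmod (v y * state y t $ j))\<^sup>2)"
  define b0 where "b0 = (\<Sum>j\<in>R. \<Sum>y\<in>Y. (cmod (v y * state y t $ j))\<^sup>2)"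
  have nn: "a1 \<ge> 0" "a0 \<ge> 0" "b1 \<ge> 0" "b0 \<ge> 0"
    by (simp_all add: a1_def a0_def b1_def b0_def sum_nonneg)
  have "(\<Sum>j<state_dim. \<Sum>x\<in>X. (cmod (u x * state (p x) t $ j))\<^sup>2) \<le> 1"
    by (rule weighted_mass[OF _ u]) (simp_all add: state_norm)
  then have a: "a1 + a0 \<le> 1" unfolding split a1_def a0_def .
  have "(\<Sum>j<state_dim. \<Sum>y\<in>Y. (cmod (v y * state y t $ j))\<^sup>2) \<le> 1"
    by (rule weighted_mass[OF _ v]) (simp_all add: state_norm)
  then have b: "b1 + b0 \<le> 1" unfolding split b1_def b0_def .
  have mass: "(\<Sum>j\<in>A. (cmod (state x t $ j))\<^sup>2) + (\<Sum>j\<in>R. (cmod (state x t $ j))\<^sup>2) = 1" for x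
    using state_norm[of t x] unfolding split by simp
  \<comment> \<open>\<open>a0\<close> and \<open>b1\<close> are the masses on the wrong outputs: the
    error is at most 1/3 on each input, and the squared weights sum to at most 1.\<close>
  have a0: "a0 \<le> 1 / 3"
    unfolding a0_def
  proof (rule weighted_mass[OF _ u])
    fix x assume "x \<in> X"
    have "output_prob n q m U out (p x) t 1 = (\<Sum>j\<in>A. (cmod (state (p x) t $ j))\<^sup>2)"
      unfolding output_prob_def A_def by (intro sum.cong) auto
    then show "(\<Sum>j\<in>R. (cmod (state (p x) t $ j))\<^sup>2) \<le> 1 / 3"
      using acc[OF \<open>x \<in> X\<close>] mass[of "p x"] by linarith
  qed simp
  have b1: "b1 \<le> 1 / 3"
    unfolding b1_def
  proof (rule weighted_mass[OF _ v])
    fix y assume "y \<in> Y"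
    have "output_prob n q m U out y t 0 \<le> (\<Sum>j\<in>R. (cmod (state y t $ j))\<^sup>2)"
      unfolding output_prob_def R_def by (intro sum_mono2) auto
    then show "(\<Sum>j\<in>A. (cmod (state y t $ j))\<^sup>2) \<le> 1 / 3"
      using rej[OF \<open>y \<in> Y\<close>] mass[of y] by linarith
  qed simp
  have amgm: "sqrt a * sqrt b \<le> (7 / 10 * a + 10 / 7 * b) / 2" if "a \<ge> 0" "b \<ge> 0" for a b :: real
    using arith_geo_mean_sqrt[of "7 / 10 * a" "10 / 7 * b"] that by (simp add: real_sqrt_mult)
  have "cmod (progress X Y G p u v t) \<le>
      cmod (\<Sum>j\<in>A. form X Y G (\<lambda>x. u x * state (p x) t $ j) (\<lambda>y. v y * state y t $ j)) +
      cmod (\<Sum>j\<in>R. form X Y G (\<lambda>x. u x * state (p x) t $ j) (\<lambda>y. v y * state y t $ j))"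
    unfolding progress_def split by (rule norm_triangle_ineq)
  also have "\<dots> \<le> N * (sqrt a1 * sqrt b1) + N * (sqrt a0 * sqrt b0)"
    unfolding a1_def a0_def b1_def b0_def by (intro add_mono form_bounded_vector G N)
  also have "\<dots> = N * (sqrt a1 * sqrt b1 + sqrt b0 * sqrt a0)" by (simp add: algebra_simps)
  also have "\<dots> \<le> N * (943 / 1000)"
  proof (rule mult_left_mono[OF _ N])
    \<comment> \<open>With \<open>a1 \<le> 1 - a0\<close> and \<open>b0 \<le> 1 - b1\<close> the sum
      of the two bounds becomes an increasing function of \<open>a0 + b1 \<le> 2/3\<close>; its
      value there is 33/35, just below 943/1000.\<close>
    have "r + s \<le> 943 / 1000"
      if "r \<le> (7 / 10 * a1 + 10 / 7 * b1) / 2" "s \<le> (7 / 10 * b0 + 10 / 7 * a0) / 2" for r s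
      using that a b a0 b1 by argo
    then show "sqrt a1 * sqrt b1 + sqrt b0 * sqrt a0 \<le> 943 / 1000"
      using amgm[OF nn(1,3)] amgm[OF nn(4,2)] by blast
  qed
  finally show ?thesis by simp
qed

end

text \<open>For near-maximising vectors the progress starts at \<open>99/100 * N\<close> or more,
  ends at \<open>943/1000 * N\<close> or less, and moves by at most \<open>2 * D\<close> per query,
  where \<open>N \<ge> M\<close>. The gap \<open>47/1000 * N\<close> yields a constant below 43,
  rounded up to 50.\<close>

theorem adversary_bound:
  fixes p :: "'a \<Rightarrow> nat \<Rightarrow> nat"
  assumes n: "0 < n" and q: "0 < q" and fin: "finite X" "finite Y"
    and X: "\<And>x. x \<in> X \<Longrightarrow> p x \<in> inputs n q \<and> f (p x) = 1"
    and Y: "\<And>y. y \<in> Y \<Longrightarrow> y \<in> inputs n q \<and> f y = 0"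
    and G: "\<And>i. i \<in> {1..n} \<Longrightarrow> form_bounded X Y (\<lambda>x y. if p x i \<noteq> y i then G x y else 0) D" and D: "D \<ge> 0"
    and u: "L2_set (\<lambda>x. cmod (u x)) X \<le> 1" and v: "L2_set (\<lambda>y. cmod (v y)) Y \<le> 1"
    and M: "cmod (form X Y G u v) \<ge> M"
    and comp: "computable_with_queries n q f t"
  shows "M \<le> 50 * real t * D"
proof (cases "M > 0")
  case True
  obtain m U out where alg: "m \<ge> 1" "\<And>s. s \<le> t \<Longrightarrow> unitary_mat (n * q * m) (U s)"
    "\<And>x. x \<in> inputs n q \<Longrightarrow> output_prob n q m U out x t (f x) \<ge> 2 / 3"
    using comp unfolding computable_with_queries_def by blast
  interpret query_algorithm n q m U t
    using n q alg by unfold_locales auto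
  obtain N u' v' where N: "N \<ge> M" "form_bounded X Y G N"
    and u': "L2_set (\<lambda>x. cmod (u' x)) X \<le> 1" and v': "L2_set (\<lambda>y. cmod (v' y)) Y \<le> 1"
    and uv: "cmod (form X Y G u' v') \<ge> 99 / 100 * N"
    using near_maximiser[OF fin M True u v] by blast
  have "cmod (progress X Y G p u' v' t) \<le> 943 / 1000 * N"
  proof (rule progress_final[OF N(2) _ u' v', where out = out])
    show "2 / 3 \<le> output_prob n q m U out (p x) t 1" if "x \<in> X" for x
      using alg(3)[of "p x"] X[OF that] by simp
    show "2 / 3 \<le> output_prob n q m U out y t 0" if "y \<in> Y" for y
      using alg(3)[of y] Y[OF that] by simp
  qed (use N(1) True in simp)
  moreover have "cmod (progress X Y G p u' v' t - progress X Y G p u' v' 0) \<le> 2 * real t * D"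
    by (rule progress_change) (use G D u' v' in auto)
  moreover have "cmod (progress X Y G p u' v' 0) \<le>
      cmod (progress X Y G p u' v' t) + cmod (progress X Y G p u' v' t - progress X Y G p u' v' 0)"
    by (metis norm_minus_commute norm_triangle_sub)
  ultimately have "99 / 100 * N \<le> 943 / 1000 * N + 2 * (real t * D)"
    using uv unfolding progress_0 by linarith
  moreover have "real t * D \<ge> 0" using D by simp
  ultimately show ?thesis using N(1) by linarith
next
  case False
  then show ?thesis using D by (smt (verit) mult_nonneg_nonneg of_nat_0_le_iff)
qed

section \<open>The orthogonal decomposition of functions on the inputs\<close>

text \<open>The entries of the matrix \<open>E\<^sub>A\<close>; \<open>proj\<close> is its action on
  functions.\<close>

definition proj_kernel :: "nat \<Rightarrow> nat \<Rightarrow> nat set \<Rightarrow> (nat \<Rightarrow> nat) \<Rightarrow> (nat \<Rightarrow> nat) \<Rightarrow> real" where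
  "proj_kernel n q A x y =
     (\<Prod>j\<in>{1..n}. if j \<in> A then of_bool (x j = y j) - 1 / real q else 1 / real q)"

definition proj :: "nat \<Rightarrow> nat \<Rightarrow> nat set \<Rightarrow> ((nat \<Rightarrow> nat) \<Rightarrow> complex) \<Rightarrow> (nat \<Rightarrow> nat) \<Rightarrow> complex" where
  "proj n q A g x = (\<Sum>y\<in>inputs n q. of_real (proj_kernel n q A x y) * g y)"

lemma finite_inputs [simp]: "finite (inputs n q)"
  unfolding inputs_def by (simp add: finite_PiE)

lemma proj_kernel_sym: "proj_kernel n q A x y = proj_kernel n q A y x"
  unfolding proj_kernel_def by (intro prod.cong) auto

lemma proj_kernel_upd:
  assumes "s \<notin> A"
  shows "proj_kernel n q A (x(s := a)) y = proj_kernel n q A x y"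
  unfolding proj_kernel_def by (intro prod.cong) (use assms in auto)

text \<open>Only the factor at \<open>i\<close> changes: it is \<open>1/q\<close> without
  \<open>i\<close>, and \<open>0 - 1/q\<close> with \<open>i\<close> because the symbols
  differ.\<close>

lemma proj_kernel_insert:
  assumes "i \<in> {1..n}" "i \<notin> A" "x i \<noteq> y i"
  shows "proj_kernel n q (insert i A) x y = - proj_kernel n q A x y"
proof -
  have "(\<Prod>j\<in>{1..n} - {i}. if j \<in> insert i A then of_bool (x j = y j) - 1 / real q else 1 / real q) =
      (\<Prod>j\<in>{1..n} - {i}. if j \<in> A then of_bool (x j = y j) - 1 / real q else 1 / real q)"
    by (intro prod.cong) auto
  then show ?thesis
    unfolding proj_kernel_def using assms by (subst (1 2) prod.remove[of "{1..n}" i]) auto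
qed

text \<open>Entrywise form of the fact that \<open>I - J/q\<close> and \<open>J/q\<close> are
  idempotents with product 0. It is the one-coordinate case of the orthogonality of the
  projections.\<close>

lemma sum_coordinate_kernels:
  assumes "u \<in> {1..q}" "v \<in> {1..q}"
  defines "r \<equiv> 1 / real q"
  shows "(\<Sum>c\<in>{1..q}. (of_bool (u = c) - r) * (of_bool (c = v) - r)) = of_bool (u = v) - r"
    and "(\<Sum>c\<in>{1..q}. (of_bool (u = c) - r) * r) = 0"
    and "(\<Sum>c\<in>{1..q}. r * (of_bool (c = v) - r)) = 0"
    and "(\<Sum>c\<in>{1..q}. r * r) = r"
proof -
  have rq: "real q * r = 1" using assms(1) by (auto simp: r_def)
  have 1: "(\<Sum>c\<in>{1..q}. of_bool (u = c)) = (1::real)"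
    using sum_of_bool_mult[of "{1..q}" u "\<lambda>_. 1"] assms(1) by simp
  have 2: "(\<Sum>c\<in>{1..q}. of_bool (c = v)) = (1::real)"
    using sum_of_bool_mult[of "{1..q}" v "\<lambda>_. 1"] assms(2) by (simp add: eq_commute[of _ v])
  have 3: "(\<Sum>c\<in>{1..q}. of_bool (u = c) * of_bool (c = v)) = (of_bool (u = v) :: real)"
    by (rule sum_of_bool_mult) (use assms(1) in auto)
  have c: "(\<Sum>c\<in>{1..q}. z) = real q * z" for z :: real by simp
  show 4: "(\<Sum>c\<in>{1..q}. (of_bool (u = c) - r) * r) = 0"
    by (simp only: sum_distrib_right[symmetric] sum_subtractf 1 c rq) simp
  show 5: "(\<Sum>c\<in>{1..q}. r * (of_bool (c = v) - r)) = 0"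
    by (simp only: sum_distrib_left[symmetric] sum_subtractf 2 c rq) simp
  show "(\<Sum>c\<in>{1..q}. r * r) = r"
    by (simp only: c mult.assoc[symmetric] rq mult_1)
  have "(\<Sum>c\<in>{1..q}. (of_bool (u = c) - r) * (of_bool (c = v) - r)) =
      (\<Sum>c\<in>{1..q}. of_bool (u = c) * of_bool (c = v) - of_bool (u = c) * r - r * (of_bool (c = v) - r))"
    by (intro sum.cong refl) (simp only: left_diff_distrib right_diff_distrib)
  also have "\<dots> = of_bool (u = v) - r"
    by (simp only: sum_subtractf 3 5 sum_distrib_right[symmetric] 1 mult_1 diff_zero)
  finally show "(\<Sum>c\<in>{1..q}. (of_bool (u = c) - r) * (of_bool (c = v) - r)) = of_bool (u = v) - r" .
qed

lemma proj_kernel_comp: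
  assumes "x \<in> inputs n q" "y \<in> inputs n q" "A \<subseteq> {1..n}" "B \<subseteq> {1..n}"
  shows "(\<Sum>z\<in>inputs n q. proj_kernel n q A x z * proj_kernel n q B z y) = (if A = B then proj_kernel n q A x y else 0)"
proof -
  let ?e = "\<lambda>A j a b. if j \<in> A then of_bool (a = b) - 1 / real q else 1 / real q"
  have coord: "(\<Sum>c\<in>{1..q}. ?e A j (x j) c * ?e B j c (y j)) =
      (if j \<in> A \<longleftrightarrow> j \<in> B then ?e A j (x j) (y j) else 0)" if "j \<in> {1..n}" for j
  proof -
    have "x j \<in> {1..q}" "y j \<in> {1..q}"
      using assms that unfolding inputs_def by (auto simp: PiE_mem)
    note coords = sum_coordinate_kernels[OF this]
    show ?thesis
      by (cases "j \<in> A"; cases "j \<in> B") (simp_all only: coords if_True if_False simp_thms)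
  qed
  have "(\<Sum>z\<in>inputs n q. proj_kernel n q A x z * proj_kernel n q B z y) =
      (\<Prod>j\<in>{1..n}. \<Sum>c\<in>{1..q}. ?e A j (x j) c * ?e B j c (y j))"
    unfolding proj_kernel_def inputs_def prod.distrib[symmetric] by (subst prod_sum_PiE) auto
  also have "\<dots> = (\<Prod>j\<in>{1..n}. if j \<in> A \<longleftrightarrow> j \<in> B then ?e A j (x j) (y j) else 0)"
    by (intro prod.cong refl coord)
  also have "\<dots> = (if A = B then proj_kernel n q A x y else 0)"
  proof (cases "A = B")
    case True
    then show ?thesis by (simp add: proj_kernel_def)
  next
    case False
    then obtain j where "j \<in> {1..n}" "(j \<in> A) \<noteq> (j \<in> B)" using assms by blast
    then show ?thesis using False by (auto intro!: prod_zero)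
  qed
  finally show ?thesis .
qed

text \<open>Expanding the product of \<open>(I - J/q) + J/q = I\<close> over the coordinates
  produces one term for each \<open>A\<close>.\<close>

lemma sum_proj_kernel_index:
  assumes "x \<in> inputs n q" "y \<in> inputs n q"
  shows "(\<Sum>A\<in>Pow {1..n}. proj_kernel n q A x y) = of_bool (x = y)"
proof -
  have "(\<Sum>A\<in>Pow {1..n}. proj_kernel n q A x y) =
     (\<Sum>A\<in>Pow {1..n}. (\<Prod>j\<in>A. of_bool (x j = y j) - 1 / real q) * (\<Prod>j\<in>{1..n}-A. 1 / real q))"
  proof (intro sum.cong refl)
    fix A assume "A \<in> Pow {1..n}"
    then have "A \<subseteq> {1..n}" by simp
    then show "proj_kernel n q A x y = (\<Prod>j\<in>A. of_bool (x j = y j) - 1 / real q) * (\<Prod>j\<in>{1..n}-A. 1 / real q)"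
      unfolding proj_kernel_def by (subst prod.subset_diff[of A]) (auto simp: mult.commute intro!: arg_cong2[of _ _ _ _ "(*)"])
  qed
  also have "\<dots> = (\<Prod>j\<in>{1..n}. (of_bool (x j = y j) - 1 / real q) + 1 / real q)"
    by (rule prod_add[symmetric]) auto
  also have "\<dots> = (\<Prod>j\<in>{1..n}. of_bool (x j = y j))"
    by simp
  also have "\<dots> = of_bool (x = y)"
  proof (cases "x = y")
    case False
    then have "\<exists>j\<in>{1..n}. x j \<noteq> y j"
      using assms unfolding inputs_def by (metis PiE_ext)
    then show ?thesis using False by (auto intro!: prod_zero)
  qed simp
  finally show ?thesis .
qed

lemma proj_kernel_empty: "proj_kernel n q {} x y = 1 / real q ^ n"
  by (simp add: proj_kernel_def power_one_over)

text \<open>The kernel of the empty set is constant, so composing with it takes column sums;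
  orthogonality makes them vanish unless \<open>A\<close> is empty.\<close>

lemma sum_proj_kernel:
  assumes "y \<in> inputs n q" "A \<subseteq> {1..n}"
  shows "(\<Sum>x\<in>inputs n q. proj_kernel n q A x y) = of_bool (A = {})"
proof -
  \<comment> \<open>Needed for cancelling \<open>q ^ n\<close>: as an input exists,
    \<open>q = 0\<close> forces \<open>n = 0\<close>.\<close>
  have "q \<noteq> 0 \<or> n = 0"
    using assms PiE_mem[of y "{1..n}" "\<lambda>_. {1..q}" 1] unfolding inputs_def by (cases "n = 0") auto
  then have q: "real q ^ n \<noteq> 0" by auto
  have "(\<Sum>x\<in>inputs n q. proj_kernel n q {} y x * proj_kernel n q A x y) = (if {} = A then proj_kernel n q {} y y else 0)"
    by (rule proj_kernel_comp) (use assms in auto)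
  then have "(\<Sum>x\<in>inputs n q. proj_kernel n q A x y) / real q ^ n = of_bool (A = {}) / real q ^ n"
    by (auto simp: proj_kernel_empty sum_divide_distrib split: if_splits)
  then show ?thesis using q by (simp only: divide_cancel_right) simp
qed

lemma proj_sum:
  assumes "x \<in> inputs n q"
  shows "(\<Sum>A\<in>Pow {1..n}. proj n q A g x) = g x"
proof -
  have "(\<Sum>A\<in>Pow {1..n}. proj n q A g x) =
      (\<Sum>y\<in>inputs n q. of_real (\<Sum>A\<in>Pow {1..n}. proj_kernel n q A x y) * g y)"
    unfolding proj_def by (subst sum.swap) (simp add: sum_distrib_right)
  also have "\<dots> = (\<Sum>y\<in>inputs n q. of_bool (x = y) * g y)"
    by (intro sum.cong refl) (simp only: sum_proj_kernel_index[OF assms] of_bool_def of_real_1 of_real_0 if_distrib[of complex_of_real])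
  also have "\<dots> = g x"
    using assms by (intro sum_of_bool_mult) auto
  finally show ?thesis .
qed

lemma proj_orthogonal:
  assumes "A \<subseteq> {1..n}" "B \<subseteq> {1..n}" "A \<noteq> B"
  shows "(\<Sum>x\<in>inputs n q. cnj (proj n q A g x) * proj n q B g x) = 0"
proof -
  have "(\<Sum>x\<in>inputs n q. cnj (proj n q A g x) * proj n q B g x) =
     (\<Sum>x\<in>inputs n q. \<Sum>y\<in>inputs n q. \<Sum>z\<in>inputs n q.
        of_real (proj_kernel n q A y x * proj_kernel n q B x z) * (cnj (g y) * g z))"
    unfolding proj_def cnj_sum sum_product complex_cnj_mult complex_cnj_complex_of_real
    by (intro sum.cong refl) (simp add: proj_kernel_sym[of n q A] mult_ac)
  also have "\<dots> = (\<Sum>y\<in>inputs n q. \<Sum>z\<in>inputs n q. \<Sum>x\<in>inputs n q.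
        of_real (proj_kernel n q A y x * proj_kernel n q B x z) * (cnj (g y) * g z))"
    by (subst sum.swap) (intro sum.cong refl sum.swap)
  also have "\<dots> = (\<Sum>y\<in>inputs n q. \<Sum>z\<in>inputs n q.
        of_real (\<Sum>x\<in>inputs n q. proj_kernel n q A y x * proj_kernel n q B x z) * (cnj (g y) * g z))"
    by (simp only: sum_distrib_right of_real_sum)
  also have "\<dots> = 0"
    by (intro sum.neutral ballI) (simp only: proj_kernel_comp assms, use assms in simp)
  finally show ?thesis .
qed

lemma proj_pythagoras:
  fixes \<beta> :: "nat set \<Rightarrow> real"
  assumes "F \<subseteq> Pow {1..n}"
  shows "(\<Sum>x\<in>inputs n q. (cmod (\<Sum>A\<in>F. of_real (\<beta> A) * proj n q A g x))\<^sup>2) =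
     (\<Sum>A\<in>F. (\<beta> A)\<^sup>2 * (\<Sum>x\<in>inputs n q. (cmod (proj n q A g x))\<^sup>2))"
proof -
  have fin: "finite F" using assms finite_subset by blast
  have sq: "of_real ((cmod z)\<^sup>2) = cnj z * z" for z
    by (simp only: complex_norm_square mult.commute)
  have "complex_of_real (\<Sum>x\<in>inputs n q. (cmod (\<Sum>A\<in>F. of_real (\<beta> A) * proj n q A g x))\<^sup>2) =
     (\<Sum>x\<in>inputs n q. \<Sum>A\<in>F. \<Sum>B\<in>F. of_real (\<beta> A * \<beta> B) * (cnj (proj n q A g x) * proj n q B g x))"
  proof -
    have "complex_of_real ((cmod (\<Sum>A\<in>F. of_real (\<beta> A) * proj n q A g x))\<^sup>2) =
      (\<Sum>A\<in>F. \<Sum>B\<in>F. of_real (\<beta> A * \<beta> B) * (cnj (proj n q A g x) * proj n q B g x))" for x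
      unfolding sq cnj_sum sum_product complex_cnj_mult
        complex_cnj_complex_of_real
      by (intro sum.cong refl) (simp add: mult_ac)
    then show ?thesis by (simp only: of_real_sum)
  qed
  also have "\<dots> = (\<Sum>A\<in>F. \<Sum>B\<in>F. \<Sum>x\<in>inputs n q. of_real (\<beta> A * \<beta> B) * (cnj (proj n q A g x) * proj n q B g x))"
    by (subst sum.swap) (intro sum.cong refl sum.swap)
  also have "\<dots> = (\<Sum>A\<in>F. \<Sum>B\<in>F. of_real (\<beta> A * \<beta> B) * (\<Sum>x\<in>inputs n q. cnj (proj n q A g x) * proj n q B g x))"
    by (simp only: sum_distrib_left)
  also have "\<dots> = (\<Sum>A\<in>F. \<Sum>B\<in>F. if A = B then of_real (\<beta> A * \<beta> A) * (\<Sum>x\<in>inputs n q. cnj (proj n q A g x) * proj n q A g x) else 0)"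
  proof (intro sum.cong refl)
    fix A B assume "A \<in> F" "B \<in> F"
    then show "of_real (\<beta> A * \<beta> B) * (\<Sum>x\<in>inputs n q. cnj (proj n q A g x) * proj n q B g x) =
      (if A = B then of_real (\<beta> A * \<beta> A) * (\<Sum>x\<in>inputs n q. cnj (proj n q A g x) * proj n q A g x) else 0)"
      using proj_orthogonal[of A n B q g] assms by auto
  qed
  also have "\<dots> = (\<Sum>A\<in>F. of_real (\<beta> A * \<beta> A) * (\<Sum>x\<in>inputs n q. cnj (proj n q A g x) * proj n q A g x))"
    using fin by simp
  also have "\<dots> = of_real (\<Sum>A\<in>F. (\<beta> A)\<^sup>2 * (\<Sum>x\<in>inputs n q. (cmod (proj n q A g x))\<^sup>2))"
    by (simp only: of_real_sum of_real_mult power2_eq_square[of "\<beta> _"] sq)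
  finally show ?thesis unfolding of_real_eq_iff .
qed

lemma proj_parseval:
  "(\<Sum>A\<in>Pow {1..n}. \<Sum>x\<in>inputs n q. (cmod (proj n q A g x))\<^sup>2) = (\<Sum>x\<in>inputs n q. (cmod (g x))\<^sup>2)"
proof -
  have "(\<Sum>x\<in>inputs n q. (cmod (g x))\<^sup>2) =
     (\<Sum>x\<in>inputs n q. (cmod (\<Sum>A\<in>Pow {1..n}. of_real 1 * proj n q A g x))\<^sup>2)"
    by (intro sum.cong refl) (simp only: proj_sum of_real_1 mult_1)
  then show ?thesis by (subst (asm) proj_pythagoras) simp_all
qed

lemma proj_upd: "s \<notin> A \<Longrightarrow> proj n q A g (x(s := a)) = proj n q A g x"
  unfolding proj_def by (simp add: proj_kernel_upd)

text \<open>The hypothesis on \<open>P\<close> is what the orthogonal array property says about the tuples \<open>x\<^sub>S\<close>, with \<open>s \<in> S\<close>.\<close>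

lemma sum_restrict_exactly_one:
  fixes h :: "(nat \<Rightarrow> nat) \<Rightarrow> real"
  assumes s: "s \<in> {1..n}"
    and P: "\<And>x. x \<in> inputs n q \<Longrightarrow> \<exists>!a. a \<in> {1..q} \<and> P (x(s := a))"
    and h: "\<And>x a. h (x(s := a)) = h x"
  shows "real q * (\<Sum>x | x \<in> inputs n q \<and> P x. h x) = (\<Sum>x\<in>inputs n q. h x)"
proof -
  have upd: "x(s := a) \<in> inputs n q" if "x \<in> inputs n q" "a \<in> {1..q}" for x a
    using that s unfolding inputs_def by (auto simp: PiE_def extensional_def)
  have xs: "x s \<in> {1..q}" if "x \<in> inputs n q" for x
    using that s unfolding inputs_def by (rule PiE_mem)
  have "(\<Sum>x\<in>inputs n q. h x) = (\<Sum>x\<in>inputs n q. \<Sum>a\<in>{1..q}. of_bool (P (x(s := a))) * h x)"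
  proof (intro sum.cong refl)
    fix x assume "x \<in> inputs n q"
    then obtain a where a: "{b \<in> {1..q}. P (x(s := b))} = {a}" using P[of x] by blast
    have "(\<Sum>a\<in>{1..q}. of_bool (P (x(s := a))) :: real) = card {b \<in> {1..q}. P (x(s := b))}"
      by (simp add: Int_def)
    then show "h x = (\<Sum>a\<in>{1..q}. of_bool (P (x(s := a))) * h x)"
      unfolding sum_distrib_right[symmetric] a by simp
  qed
  also have "\<dots> = (\<Sum>(x, a)\<in>inputs n q \<times> {1..q}. of_bool (P (x(s := a))) * h x)"
    by (rule sum.cartesian_product)
  \<comment> \<open>The involution exchanging \<open>x s\<close> with \<open>a\<close> turns
    \<open>P (x(s := a))\<close> into \<open>P x\<close> and leaves \<open>h\<close>
    unchanged.\<close>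
  also have "\<dots> = (\<Sum>(x, a)\<in>inputs n q \<times> {1..q}. of_bool (P x) * h x)"
    by (rule sum.reindex_bij_witness[where i = "\<lambda>(x, a). (x(s := a), x s)" and j = "\<lambda>(x, a). (x(s := a), x s)"])
       (use upd xs h in auto)
  also have "\<dots> = (\<Sum>x\<in>inputs n q. real q * (of_bool (P x) * h x))"
    by (simp add: sum.cartesian_product[symmetric])
  also have "\<dots> = real q * (\<Sum>x | x \<in> inputs n q \<and> P x. h x)"
    unfolding sum_distrib_left[symmetric] sum.inter_filter[OF finite_inputs]
    by (intro arg_cong[where f = "(*) (real q)"] sum.cong) auto
  finally show ?thesis by simp
qed

section \<open>The adversary matrix\<close>

text \<open>
  Each \<open>A\<close> with \<open>\<not> S \<subseteq> A\<close> is assigned to \<open>Min (S - A)\<close>. The components assigned to the same \<open>s\<close>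
  are independent of the coordinate \<open>s\<close>, so restricting their sum to \<open>P\<close> divides its squared norm
  by exactly \<open>q\<close>.
\<close>

lemma block_bound:
  fixes \<beta> :: "nat set \<Rightarrow> real"
  assumes S: "S \<subseteq> {1..n}"
    and P: "\<And>s x. s \<in> S \<Longrightarrow> x \<in> inputs n q \<Longrightarrow> \<exists>!a. a \<in> {1..q} \<and> P (x(s := a))"
    and \<beta>: "\<And>A. S \<subseteq> A \<Longrightarrow> \<beta> A = 0"
  shows "real q * (\<Sum>x | x \<in> inputs n q \<and> P x. (cmod (\<Sum>A\<in>Pow {1..n}. of_real (\<beta> A) * proj n q A g x))\<^sup>2)
     \<le> real (card S) * (\<Sum>A\<in>Pow {1..n}. (\<beta> A)\<^sup>2 * (\<Sum>x\<in>inputs n q. (cmod (proj n q A g x))\<^sup>2))"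
proof -
  define N where "N = {A \<in> Pow {1..n}. \<not> S \<subseteq> A}"
  define F where "F = (\<lambda>s. {A \<in> N. Min (S - A) = s})"
  define h where "h = (\<lambda>s x. \<Sum>A\<in>F s. of_real (\<beta> A) * proj n q A g x)"
  let ?w = "\<lambda>A. (\<beta> A)\<^sup>2 * (\<Sum>x\<in>inputs n q. (cmod (proj n q A g x))\<^sup>2)"
  have finS: "finite S" using S finite_subset by blast
  have finN: "finite N" unfolding N_def by simp
  have Min: "Min (S - A) \<in> S - A" if "A \<in> N" for A
    using that finS unfolding N_def by (intro Min_in) auto
  then have img: "(\<lambda>A. Min (S - A)) ` N \<subseteq> S" by blast
  have "(\<Sum>A\<in>Pow {1..n}. of_real (\<beta> A) * proj n q A g x) = (\<Sum>s\<in>S. h s x)" for x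
  proof -
    have "(\<Sum>A\<in>Pow {1..n}. of_real (\<beta> A) * proj n q A g x) = (\<Sum>A\<in>N. of_real (\<beta> A) * proj n q A g x)"
      by (rule sum.mono_neutral_right) (auto simp: N_def \<beta>)
    also have "\<dots> = (\<Sum>s\<in>S. h s x)"
      unfolding h_def F_def by (rule sum.group[OF finN finS img, symmetric])
    finally show ?thesis .
  qed
  \<comment> \<open>Cauchy-Schwarz over the classes \<open>F s\<close> is the source of the factor
    \<open>card S\<close>.\<close>
  then have "real q * (\<Sum>x | x \<in> inputs n q \<and> P x. (cmod (\<Sum>A\<in>Pow {1..n}. of_real (\<beta> A) * proj n q A g x))\<^sup>2)
      \<le> real q * (\<Sum>x | x \<in> inputs n q \<and> P x. real (card S) * (\<Sum>s\<in>S. (cmod (h s x))\<^sup>2))"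
    by (intro mult_left_mono sum_mono) (simp_all add: cmod_sum_square_le)
  also have "\<dots> = real (card S) * (\<Sum>s\<in>S. real q * (\<Sum>x | x \<in> inputs n q \<and> P x. (cmod (h s x))\<^sup>2))"
    by (subst sum_distrib_left[symmetric], subst sum.swap) (simp add: sum_distrib_left mult_ac)
  also have "\<dots> = real (card S) * (\<Sum>s\<in>S. \<Sum>x\<in>inputs n q. (cmod (h s x))\<^sup>2)"
  proof (intro arg_cong[where f = "(*) (real (card S))"] sum.cong refl sum_restrict_exactly_one)
    fix s x a assume s: "s \<in> S"
    then show "s \<in> {1..n}" using S by auto
    show "\<exists>!a. a \<in> {1..q} \<and> P (x(s := a))" if "x \<in> inputs n q" for x
      using P s that by blast
    show "(cmod (h s (x(s := a))))\<^sup>2 = (cmod (h s x))\<^sup>2" for x a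
    proof -
      have "h s (x(s := a)) = h s x" unfolding h_def
      proof (intro sum.cong refl)
        fix A assume "A \<in> F s"
        then have "s \<notin> A" using Min[of A] unfolding F_def by auto
        then show "of_real (\<beta> A) * proj n q A g (x(s := a)) = of_real (\<beta> A) * proj n q A g x"
          by (simp add: proj_upd)
      qed
      then show ?thesis by simp
    qed
  qed
  also have "\<dots> = real (card S) * (\<Sum>s\<in>S. \<Sum>A\<in>F s. ?w A)"
    unfolding h_def
    by (intro arg_cong[where f = "(*) (real (card S))"] sum.cong refl proj_pythagoras) (auto simp: F_def N_def)
  also have "\<dots> = real (card S) * (\<Sum>A\<in>N. ?w A)"
    unfolding F_def by (simp only: sum.group[OF finN finS img])
  also have "\<dots> \<le> real (card S) * (\<Sum>A\<in>Pow {1..n}. ?w A)"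
    by (intro mult_left_mono sum_mono2) (auto simp: N_def sum_nonneg)
  finally show ?thesis .
qed

text \<open>Slope at most 1 makes neighbouring coefficients nearly cancel, and the cut-off leaves
  weight only on sets \<open>A\<close> with fewer than \<open>t\<close> elements.\<close>

definition alpha :: "real \<Rightarrow> nat \<Rightarrow> real" where
  "alpha t j = max (t - real j) 0"

text \<open>\<open>P S x\<close> stands for \<open>x\<^sub>S \<in> T\<^sub>S\<close>, and
  \<open>exactly_one\<close> is the orthogonal array property expressed by changing one coordinate
  of a whole input. The equation for \<open>t\<close> encodes \<open>n\<close> to the power
  \<open>k/(k+1)\<close> with natural exponents.\<close>

locale oa_family =
  fixes n q k :: nat and P :: "nat set \<Rightarrow> (nat \<Rightarrow> nat) \<Rightarrow> bool" and t :: real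
  assumes k1: "1 \<le> k" and kn: "k \<le> n" and q1: "1 \<le> q" and t0: "t \<ge> 0" and tpow: "t ^ (k + 1) = real n ^ k"
    and exactly_one: "S \<subseteq> {1..n} \<Longrightarrow> card S = k \<Longrightarrow> s \<in> S \<Longrightarrow> x \<in> inputs n q \<Longrightarrow>
       \<exists>!a. a \<in> {1..q} \<and> P S (x(s := a))"
begin

definition index_sets :: "nat set set" where "index_sets = {S. S \<subseteq> {1..n} \<and> card S = k}"

text \<open>An input \<open>x\<close> occurs once for each \<open>S\<close> with
  \<open>P S x\<close>, so that the blocks of all \<open>S\<close> are stacked in one
  matrix.\<close>

definition rows :: "(nat set \<times> (nat \<Rightarrow> nat)) set" where
  "rows = Sigma index_sets (\<lambda>S. {x. x \<in> inputs n q \<and> P S x})"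

text \<open>In the scaling, \<open>q\<close> makes up for the fraction \<open>1/q\<close> of the
  inputs that a block keeps as rows, and \<open>n choose k\<close> for the number of blocks.\<close>

definition adv_matrix :: "nat set \<times> (nat \<Rightarrow> nat) \<Rightarrow> (nat \<Rightarrow> nat) \<Rightarrow> real" where
  "adv_matrix = (\<lambda>(S, x) y. sqrt (real q / real (n choose k)) *
     (\<Sum>A\<in>Pow {1..n}. of_bool (\<not> S \<subseteq> A) * alpha t (card A) * proj_kernel n q A x y))"

text \<open>The coefficient of \<open>E\<^sub>A\<close> once every projection whose set contains
  \<open>i\<close> has been replaced by minus the projection with \<open>i\<close> removed from the
  set.\<close>

definition beta :: "nat \<Rightarrow> nat set \<Rightarrow> nat set \<Rightarrow> real" where
  "beta i S A = (if i \<in> A then 0 else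
     of_bool (\<not> S \<subseteq> A) * alpha t (card A) - of_bool (\<not> S \<subseteq> insert i A) * alpha t (Suc (card A)))"

definition matrix_without :: "nat \<Rightarrow> nat set \<times> (nat \<Rightarrow> nat) \<Rightarrow> (nat \<Rightarrow> nat) \<Rightarrow> real" where
  "matrix_without i = (\<lambda>(S, x) y. sqrt (real q / real (n choose k)) *
     (\<Sum>A\<in>Pow {1..n}. beta i S A * proj_kernel n q A x y))"

section \<open>Bounded norm of the entries that a query can distinguish\<close>

lemma finite_index_sets [simp]: "finite index_sets"
  unfolding index_sets_def by (rule finite_subset[of _ "Pow {1..n}"]) auto

lemma card_index_sets: "card index_sets = n choose k"
  unfolding index_sets_def using n_subsets[of "{1..n}" k] by simp

lemma choose_pos: "real (n choose k) > 0"
  using kn by simp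

lemma finite_rows [simp]: "finite rows"
  unfolding rows_def by (intro finite_SigmaI) auto

text \<open>Each \<open>A\<close> avoiding \<open>i\<close> is paired with
  \<open>insert i A\<close>, whose kernel is the opposite one because the symbols at
  \<open>i\<close> differ.\<close>

lemma adv_matrix_differ:
  assumes i: "i \<in> {1..n}" and xy: "x i \<noteq> y i"
  shows "adv_matrix (S, x) y = matrix_without i (S, x) y"
proof -
  let ?N = "{1..n} - {i}"
  let ?w = "\<lambda>A. of_bool (\<not> S \<subseteq> A) * alpha t (card A)"
  have Pow: "Pow {1..n} = Pow ?N \<union> insert i ` Pow ?N"
    using Pow_insert[of i ?N] i by (simp add: insert_absorb)
  have inj: "inj_on (insert i) (Pow ?N)" by (auto simp: inj_on_def)
  have split: "(\<Sum>A\<in>Pow {1..n}. h A) = (\<Sum>A\<in>Pow ?N. h A + h (insert i A))" for h :: "nat set \<Rightarrow> real"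
  proof -
    have "sum h (insert i ` Pow ?N) = (\<Sum>A\<in>Pow ?N. h (insert i A))"
      using sum.reindex[OF inj, of h] by (simp only: o_def)
    then show ?thesis
      unfolding Pow by (subst sum.union_disjoint) (auto simp: sum.distrib)
  qed
  have "(\<Sum>A\<in>Pow {1..n}. ?w A * proj_kernel n q A x y) = (\<Sum>A\<in>Pow {1..n}. beta i S A * proj_kernel n q A x y)"
    unfolding split
  proof (intro sum.cong refl)
    fix A assume "A \<in> Pow ?N"
    then have A: "i \<notin> A" "finite A" using finite_subset[of A "{1..n}"] by auto
    show "?w A * proj_kernel n q A x y + ?w (insert i A) * proj_kernel n q (insert i A) x y =
       beta i S A * proj_kernel n q A x y + beta i S (insert i A) * proj_kernel n q (insert i A) x y"
      using A proj_kernel_insert[of i n A x y q] i xy by (simp add: beta_def algebra_simps)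
  qed
  then show ?thesis unfolding adv_matrix_def matrix_without_def by simp
qed

lemma beta_eq_0: "S \<subseteq> A \<Longrightarrow> beta i S A = 0"
  unfolding beta_def by auto

lemma beta_square_le:
  "(beta i S A)\<^sup>2 \<le> 1 + of_bool (i \<in> S \<and> S - {i} \<subseteq> A) * (alpha t (card A))\<^sup>2"
proof (cases "i \<in> A \<or> S \<subseteq> A")
  case True
  then show ?thesis unfolding beta_def by auto
next
  case False
  show ?thesis
  proof (cases "S \<subseteq> insert i A")
    case True
    \<comment> \<open>In this case \<open>S - A = {i}\<close>: the second indicator vanishes and
      \<open>alpha t (card A)\<close> remains uncancelled.\<close>
    then have "i \<in> S \<and> S - {i} \<subseteq> A" using False by blast
    then show ?thesis using False True unfolding beta_def by auto
  next
    case f2: False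
    have "\<bar>alpha t (card A) - alpha t (Suc (card A))\<bar> \<le> 1"
      unfolding alpha_def by (simp add: max_def)
    then have "(alpha t (card A) - alpha t (Suc (card A)))\<^sup>2 \<le> 1"
      by (simp add: abs_square_le_1)
    then show ?thesis using False f2 unfolding beta_def by (simp add: add_increasing2)
  qed
qed

text \<open>Removing \<open>i\<close> is injective on these \<open>S\<close> and leaves a subset of
  \<open>A\<close> with \<open>k - 1\<close> elements.\<close>

lemma card_almost_contained:
  assumes "finite A"
  shows "card {S \<in> index_sets. i \<in> S \<and> S - {i} \<subseteq> A} \<le> card A ^ (k - 1)"
proof -
  let ?M = "{S \<in> index_sets. i \<in> S \<and> S - {i} \<subseteq> A}"
  have "card ?M \<le> card {B. B \<subseteq> A \<and> card B = k - 1}"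
  proof (rule card_inj_on_le[where f = "\<lambda>S. S - {i}"])
    show "inj_on (\<lambda>S. S - {i}) ?M"
      by (rule inj_onI) (metis (no_types, lifting) insert_Diff mem_Collect_eq)
    show "finite {B. B \<subseteq> A \<and> card B = k - 1}"
      by (rule finite_subset[of _ "Pow A"]) (use assms in auto)
  qed (auto simp: index_sets_def card_Diff_singleton)
  also have "\<dots> = card A choose (k - 1)" using n_subsets[OF assms] by simp
  also have "\<dots> \<le> card A ^ (k - 1)"
    by (cases "k - 1 \<le> card A") (simp_all add: binomial_le_pow binomial_eq_0)
  finally show ?thesis .
qed

text \<open>Each \<open>S\<close> contributes at most 1, apart from the exceptional ones. If
  \<open>card A \<le> t\<close>, those number at most \<open>t ^ (k - 1)\<close> and add at most
  \<open>t\<^sup>2\<close> each, in total \<open>t ^ (k + 1) = n ^ k\<close>, which is of the order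
  of the number of sets \<open>S\<close>; for larger \<open>A\<close> they add 0. This balance fixes
  the exponent \<open>k / (k + 1)\<close>.\<close>

lemma sum_beta_square_le:
  assumes A: "finite A"
  shows "(\<Sum>S\<in>index_sets. (beta i S A)\<^sup>2) \<le> (1 + real k ^ k) * real (n choose k)"
proof -
  let ?M = "{S \<in> index_sets. i \<in> S \<and> S - {i} \<subseteq> A}"
  have "(\<Sum>S\<in>index_sets. (beta i S A)\<^sup>2) \<le> (\<Sum>S\<in>index_sets. 1 + of_bool (i \<in> S \<and> S - {i} \<subseteq> A) * (alpha t (card A))\<^sup>2)"
    by (intro sum_mono beta_square_le)
  also have "\<dots> = real (n choose k) + real (card ?M) * (alpha t (card A))\<^sup>2"
    by (simp add: sum.distrib card_index_sets sum_distrib_right[symmetric] Int_def conj_commute)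
  also have "\<dots> \<le> real (n choose k) + t ^ (k + 1)"
  proof (cases "real (card A) \<le> t")
    case True
    have "real (card ?M) \<le> real (card A) ^ (k - 1)"
      using card_almost_contained[OF A, of i] of_nat_mono[where 'a = real] by fastforce
    also have "\<dots> \<le> t ^ (k - 1)" using True by (intro power_mono) auto
    finally have "real (card ?M) * (alpha t (card A))\<^sup>2 \<le> t ^ (k - 1) * t ^ 2"
      using True t0 by (intro mult_mono power_mono) (auto simp: alpha_def)
    also have "\<dots> = t ^ (k + 1)"
      using k1 by (simp flip: power_add)
    finally show ?thesis by simp
  next
    case False
    then show ?thesis using t0 by (simp add: alpha_def)
  qed
  also have "t ^ (k + 1) \<le> real k ^ k * real (n choose k)"
  proof -
    have "(real n / real k) ^ k \<le> real (n choose k)"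
      using binomial_ge_n_over_k_pow_k[OF kn, where 'a = real] by simp
    then show ?thesis unfolding tpow using k1 by (simp add: power_divide field_simps)
  qed
  finally show ?thesis by (simp add: algebra_simps)
qed

text \<open>Cauchy-Schwarz over the rows reduces the claim to the squared norm of the matrix applied
  to \<open>g\<close>. Each \<open>S\<close> is handled by \<open>block_bound\<close>, the sum over
  \<open>S\<close> is then estimated for each fixed \<open>A\<close>, and Parseval adds up the
  components.\<close>

lemma matrix_without_bounded:
  assumes Y: "Y \<subseteq> inputs n q"
  shows "form_bounded rows Y (matrix_without i) (sqrt (real k * (1 + real k ^ k)))"
  unfolding form_bounded_def
proof (intro allI)
  fix f :: "nat set \<times> (nat \<Rightarrow> nat) \<Rightarrow> complex" and g :: "(nat \<Rightarrow> nat) \<Rightarrow> complex"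
  \<comment> \<open>Extension by zero gives a function on all inputs, to which the orthogonal
    decomposition applies.\<close>
  define g' where "g' = (\<lambda>y. if y \<in> Y then g y else 0)"
  define c where "c = sqrt (real q / real (n choose k))"
  define V where "V = (\<lambda>S x. \<Sum>A\<in>Pow {1..n}. of_real (beta i S A) * proj n q A g' x)"
  define w where "w = (\<lambda>A. \<Sum>x\<in>inputs n q. (cmod (proj n q A g' x))\<^sup>2)"
  let ?D = "real k * (1 + real k ^ k)"
  have row: "(\<Sum>y\<in>Y. of_real (matrix_without i (S, x) y) * g y) = of_real c * V S x" for S x
  proof -
    have "V S x = (\<Sum>A\<in>Pow {1..n}. \<Sum>y\<in>inputs n q. of_real (beta i S A * proj_kernel n q A x y) * g' y)"
      unfolding V_def proj_def by (simp add: sum_distrib_left mult.assoc)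
    also have "\<dots> = (\<Sum>y\<in>inputs n q. (\<Sum>A\<in>Pow {1..n}. of_real (beta i S A * proj_kernel n q A x y)) * g' y)"
      by (subst sum.swap) (simp add: sum_distrib_right)
    also have "\<dots> = (\<Sum>y\<in>Y. of_real (\<Sum>A\<in>Pow {1..n}. beta i S A * proj_kernel n q A x y) * g y)"
      by (rule sum.mono_neutral_cong_right) (use Y in \<open>auto simp: g'_def\<close>)
    finally show ?thesis
      unfolding matrix_without_def c_def[symmetric] prod.case
      by (simp only: of_real_mult mult.assoc sum_distrib_left[symmetric])
  qed
  have "form rows Y (matrix_without i) f g = (\<Sum>r\<in>rows. cnj (f r) * (of_real c * V (fst r) (snd r)))"
    unfolding form_def row[symmetric] prod.collapse
    by (simp add: sum_distrib_left mult_ac)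
  then have "cmod (form rows Y (matrix_without i) f g) \<le>
      (\<Sum>r\<in>rows. \<bar>cmod (f r)\<bar> * \<bar>c * cmod (V (fst r) (snd r))\<bar>)"
    by (auto intro!: order_trans[OF norm_sum] sum_mono simp: norm_mult abs_mult)
  also have "\<dots> \<le> L2_set (\<lambda>r. cmod (f r)) rows * L2_set (\<lambda>r. c * cmod (V (fst r) (snd r))) rows"
    by (rule L2_set_mult_ineq)
  also have "\<dots> \<le> L2_set (\<lambda>r. cmod (f r)) rows * (sqrt ?D * L2_set (\<lambda>y. cmod (g y)) Y)"
  proof (rule mult_left_mono)
    have "(\<Sum>r\<in>rows. (c * cmod (V (fst r) (snd r)))\<^sup>2) =
        (\<Sum>S\<in>index_sets. \<Sum>x | x \<in> inputs n q \<and> P S x. c\<^sup>2 * (cmod (V S x))\<^sup>2)"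
      unfolding rows_def by (subst sum.Sigma) (auto simp: case_prod_beta power_mult_distrib)
    \<comment> \<open>The factor \<open>q\<close> from \<open>c\<^sup>2\<close> is absorbed by
      \<open>block_bound\<close>, the binomial coefficient by the bound for the sum over
      \<open>S\<close>.\<close>
    also have "\<dots> = (\<Sum>S\<in>index_sets. real q * (\<Sum>x | x \<in> inputs n q \<and> P S x. (cmod (V S x))\<^sup>2)) / real (n choose k)"
      unfolding c_def by (simp add: sum_distrib_left sum_divide_distrib)
    also have "\<dots> \<le> (\<Sum>S\<in>index_sets. real k * (\<Sum>A\<in>Pow {1..n}. (beta i S A)\<^sup>2 * w A)) / real (n choose k)"
    proof (intro divide_right_mono sum_mono)
      fix S assume "S \<in> index_sets"
      then have S: "S \<subseteq> {1..n}" "card S = k" unfolding index_sets_def by auto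
      show "real q * (\<Sum>x | x \<in> inputs n q \<and> P S x. (cmod (V S x))\<^sup>2) \<le>
          real k * (\<Sum>A\<in>Pow {1..n}. (beta i S A)\<^sup>2 * w A)"
        using block_bound[of S n q "P S" "beta i S" g'] exactly_one[OF S] S beta_eq_0
        unfolding V_def w_def by auto
    qed simp
    also have "\<dots> = real k / real (n choose k) * (\<Sum>A\<in>Pow {1..n}. (\<Sum>S\<in>index_sets. (beta i S A)\<^sup>2) * w A)"
      by (subst sum_distrib_left[symmetric], subst sum.swap) (simp add: sum_distrib_right)
    also have "\<dots> \<le> real k / real (n choose k) * (\<Sum>A\<in>Pow {1..n}. ((1 + real k ^ k) * real (n choose k)) * w A)"
    proof (intro mult_left_mono sum_mono mult_right_mono)
      fix A assume "A \<in> Pow {1..n}"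
      then show "(\<Sum>S\<in>index_sets. (beta i S A)\<^sup>2) \<le> (1 + real k ^ k) * real (n choose k)"
        by (intro sum_beta_square_le) (auto intro: finite_subset)
    qed (auto simp: w_def sum_nonneg)
    also have "\<dots> = ?D * (\<Sum>A\<in>Pow {1..n}. w A)"
      using choose_pos by (simp add: sum_distrib_left[symmetric])
    also have "\<dots> = ?D * (\<Sum>x\<in>inputs n q. (cmod (g' x))\<^sup>2)"
      unfolding w_def proj_parseval ..
    also have "(\<Sum>x\<in>inputs n q. (cmod (g' x))\<^sup>2) = (\<Sum>y\<in>Y. (cmod (g y))\<^sup>2)"
      by (rule sum.mono_neutral_cong_right) (use Y in \<open>auto simp: g'_def\<close>)
    finally show "L2_set (\<lambda>r. c * cmod (V (fst r) (snd r))) rows \<le> sqrt ?D * L2_set (\<lambda>y. cmod (g y)) Y"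
      unfolding L2_set_def real_sqrt_mult[symmetric] by (rule real_sqrt_le_mono)
  qed simp
  finally show "cmod (form rows Y (matrix_without i) f g) \<le>
      sqrt ?D * (L2_set (\<lambda>r. cmod (f r)) rows * L2_set (\<lambda>y. cmod (g y)) Y)"
    by (simp only: mult_ac)
qed

lemma adv_matrix_differ_bounded:
  assumes Y: "Y \<subseteq> inputs n q" and i: "i \<in> {1..n}"
  shows "form_bounded rows Y (\<lambda>r y. if snd r i \<noteq> y i then adv_matrix r y else 0) (2 * sqrt (real k * (1 + real k ^ k)))"
proof -
  have "(\<lambda>r y. if snd r i \<noteq> y i then adv_matrix r y else 0) = (\<lambda>r y. if snd r i \<noteq> y i then matrix_without i r y else 0)"
    using adv_matrix_differ[OF i] by (auto simp: fun_eq_iff)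
  moreover have "form_bounded rows Y (\<lambda>r y. if snd r i \<noteq> y i then matrix_without i r y else 0)
      (2 * sqrt (real k * (1 + real k ^ k)))"
    by (rule form_bounded_differ[where c = "\<lambda>r. snd r i" and c' = "\<lambda>y. y i"])
       (use matrix_without_bounded[OF Y] finite_subset[OF Y] in auto)
  ultimately show ?thesis by simp
qed

section \<open>The form of the matrix at uniform vectors\<close>

lemma sum_restrict:
  assumes "S \<in> index_sets" "\<And>x a s. s \<in> S \<Longrightarrow> s \<notin> A \<Longrightarrow> h (x(s := a)) = h x" "\<not> S \<subseteq> A"
  shows "real q * (\<Sum>x | x \<in> inputs n q \<and> P S x. h x) = (\<Sum>x\<in>inputs n q. h x)"
proof -
  obtain s where "s \<in> S" "s \<notin> A" using assms by blast
  then show ?thesis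
    using assms exactly_one by (intro sum_restrict_exactly_one[of s]) (auto simp: index_sets_def)
qed

lemma not_subset_empty: "S \<in> index_sets \<Longrightarrow> \<not> S \<subseteq> {}"
  using k1 by (auto simp: index_sets_def)

lemma card_restrict:
  assumes "S \<in> index_sets"
  shows "real q * real (card {x. x \<in> inputs n q \<and> P S x}) = real q ^ n"
proof -
  have "real q * (\<Sum>x | x \<in> inputs n q \<and> P S x. 1) = (\<Sum>x\<in>inputs n q. 1)"
    by (rule sum_restrict[OF assms _ not_subset_empty[OF assms]]) auto
  then show ?thesis by (simp add: inputs_def card_PiE)
qed

lemma card_rows: "real q * real (card rows) = real (n choose k) * real q ^ n"
proof -
  have "real q * real (card rows) = (\<Sum>S\<in>index_sets. real q * real (card {x. x \<in> inputs n q \<and> P S x}))"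
    unfolding rows_def by (subst card_SigmaI) (auto simp: sum_distrib_left)
  also have "\<dots> = real (n choose k) * real q ^ n"
    by (simp add: card_restrict card_index_sets)
  finally show ?thesis .
qed

text \<open>Uniqueness at a coordinate in \<open>S - A\<close> makes the sum over the rows of the
  block \<open>1/q\<close> times the sum over all inputs, which vanishes for nonempty
  \<open>A\<close>. Only the coefficient \<open>alpha t 0 = t\<close> survives.\<close>

lemma sum_adv_matrix:
  assumes S: "S \<in> index_sets" and y: "y \<in> inputs n q"
  shows "(\<Sum>x | x \<in> inputs n q \<and> P S x. adv_matrix (S, x) y) = sqrt (real q / real (n choose k)) * t / real q"
proof -
  let ?c = "sqrt (real q / real (n choose k))"
  have proj_kernel: "of_bool (\<not> S \<subseteq> A) * alpha t (card A) * (\<Sum>x | x \<in> inputs n q \<and> P S x. proj_kernel n q A x y) =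
      (if A = {} then t / real q else 0)" if "A \<in> Pow {1..n}" for A
  proof (cases "S \<subseteq> A")
    case True
    then show ?thesis using not_subset_empty[OF S] by auto
  next
    case False
    have "real q * (\<Sum>x | x \<in> inputs n q \<and> P S x. proj_kernel n q A x y) = (\<Sum>x\<in>inputs n q. proj_kernel n q A x y)"
      by (rule sum_restrict[OF S _ False]) (simp add: proj_kernel_upd)
    then have "(\<Sum>x | x \<in> inputs n q \<and> P S x. proj_kernel n q A x y) = of_bool (A = {}) / real q"
      using sum_proj_kernel[OF y, of A] that q1 by (simp add: field_simps)
    then show ?thesis using False t0 by (auto simp: alpha_def)
  qed
  have "(\<Sum>x | x \<in> inputs n q \<and> P S x. adv_matrix (S, x) y) =
      ?c * (\<Sum>A\<in>Pow {1..n}. of_bool (\<not> S \<subseteq> A) * alpha t (card A) * (\<Sum>x | x \<in> inputs n q \<and> P S x. proj_kernel n q A x y))"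
    unfolding adv_matrix_def prod.case sum_distrib_left[symmetric]
    by (subst sum.swap) (simp add: sum_distrib_left)
  also have "\<dots> = ?c * (\<Sum>A\<in>Pow {1..n}. if A = {} then t / real q else 0)"
    by (simp only: proj_kernel cong: sum.cong)
  also have "\<dots> = ?c * t / real q" by simp
  finally show ?thesis .
qed

text \<open>The witnesses are the normalised constant vectors. The form is then \<open>t\<close>
  times the square root of the density of \<open>Y\<close> among the inputs, and density 1/4 gives
  \<open>t / 2\<close>.\<close>

lemma adv_matrix_large:
  assumes Y: "Y \<subseteq> inputs n q" and cardY: "real (card Y) \<ge> real q ^ n / 4"
  obtains f g where "L2_set (\<lambda>r. cmod (f r)) rows \<le> 1" "L2_set (\<lambda>y. cmod (g y)) Y \<le> 1"
    "cmod (form rows Y adv_matrix f g) \<ge> t / 2"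
proof
  define C where "C = real (n choose k)"
  define R where "R = real (card rows)"
  define N where "N = real (card Y)"
  let ?f = "\<lambda>r. complex_of_real (1 / sqrt R)" and ?g = "\<lambda>y. complex_of_real (1 / sqrt N)"
  have Q: "real q ^ n > 0" "real q > 0" using q1 by auto
  have C0: "C > 0" using choose_pos by (simp add: C_def)
  have R: "R = C * real q ^ n / real q" using card_rows Q by (simp add: R_def C_def field_simps)
  have R0: "R > 0" unfolding R using C0 Q by simp
  have N0: "N > 0" unfolding N_def using cardY Q by linarith
  show "L2_set (\<lambda>r. cmod (?f r)) rows \<le> 1"
    using R0 by (simp add: L2_set_constant norm_divide R_def[symmetric])
  show "L2_set (\<lambda>y. cmod (?g y)) Y \<le> 1"
    using N0 by (simp add: L2_set_constant norm_divide N_def[symmetric])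
  have "form rows Y adv_matrix ?f ?g = of_real ((\<Sum>r\<in>rows. \<Sum>y\<in>Y. adv_matrix r y) * (1 / sqrt R * (1 / sqrt N)))"
    unfolding form_def by (simp add: sum_divide_distrib)
  moreover have "(\<Sum>r\<in>rows. \<Sum>y\<in>Y. adv_matrix r y) = N * C * (sqrt (real q / C) * t / real q)"
  proof -
    have "(\<Sum>r\<in>rows. \<Sum>y\<in>Y. adv_matrix r y) = (\<Sum>y\<in>Y. \<Sum>S\<in>index_sets. \<Sum>x | x \<in> inputs n q \<and> P S x. adv_matrix (S, x) y)"
      unfolding rows_def by (subst sum.swap, subst sum.Sigma) (auto simp: case_prod_beta)
    also have "\<dots> = (\<Sum>y\<in>Y. \<Sum>S\<in>index_sets. sqrt (real q / C) * t / real q)"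
      unfolding C_def by (intro sum.cong refl sum_adv_matrix) (use Y in auto)
    finally show ?thesis by (simp add: card_index_sets C_def N_def)
  qed
  moreover have "N * C * (sqrt (real q / C) * t / real q) * (1 / sqrt R * (1 / sqrt N)) = t * sqrt (N / real q ^ n)"
  proof -
    \<comment> \<open>The variables stand for the square roots of \<open>C\<close>,
      \<open>q\<close>, \<open>N\<close> and \<open>q ^ n\<close>, so that only rational arithmetic
      remains.\<close>
    have "c\<^sup>2 * a\<^sup>2 * (b / a * t / b\<^sup>2) * (1 / (a * d / b) * (1 / c)) = t * (c / d)"
      if "a > 0" "b > 0" "c > 0" "d > 0" for a b c d :: real
      using that by (simp add: field_simps power2_eq_square)
    from this[of "sqrt C" "sqrt (real q)" "sqrt N" "sqrt (real q ^ n)"] show ?thesis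
      using N0 C0 Q unfolding R by (simp add: real_sqrt_divide real_sqrt_mult)
  qed
  ultimately have eq: "form rows Y adv_matrix ?f ?g = of_real (t * sqrt (N / real q ^ n))" by (simp only:)
  have "sqrt (N / real q ^ n) \<ge> sqrt (1 / 4)"
    using cardY Q by (intro real_sqrt_le_mono) (simp add: N_def field_simps)
  then have "sqrt (N / real q ^ n) \<ge> 1 / 2" by (simp add: real_sqrt_divide)
  then have "t * sqrt (N / real q ^ n) \<ge> t * (1 / 2)" using t0 by (intro mult_left_mono)
  then show "cmod (form rows Y adv_matrix ?f ?g) \<ge> t / 2"
    unfolding eq norm_of_real by (intro order_trans[OF _ abs_ge_self]) simp
qed

end

section \<open>The lower bound\<close>

lemma orthogonal_array_exactly_one:
  assumes T: "orthogonal_array k q (T S)" and S: "S \<subseteq> {1..n}" "card S = k" and s: "s \<in> S"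
    and x: "x \<in> inputs n q"
  shows "\<exists>!a. a \<in> {1..q} \<and> restrict_tuple (x(s := a)) S \<in> T S"
proof -
  have fin: "finite S" using S finite_subset by blast
  obtain us vs where l: "sorted_list_of_set S = us @ s # vs"
    using s fin split_list[of s "sorted_list_of_set S"] by auto
  \<comment> \<open>The sorted list has no repetitions, so changing the symbol at \<open>s\<close>
    changes exactly one entry of the tuple.\<close>
  have "distinct (us @ s # vs)" "set (us @ s # vs) = S" "length (us @ s # vs) = card S"
    using fin unfolding l[symmetric] by auto
  then have d: "s \<notin> set us" "s \<notin> set vs" "set us \<subseteq> S" "set vs \<subseteq> S" "length us + 1 + length vs = k"
    using S by auto
  have "x j \<in> {1..q}" if "j \<in> S" for j
    using that S x unfolding inputs_def by (auto simp: PiE_mem)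
  then have "set (map x us) \<subseteq> {1..q}" "set (map x vs) \<subseteq> {1..q}" using d by auto
  then have "\<exists>!a. a \<in> {1..q} \<and> map x us @ a # map x vs \<in> T S"
    using T d(5) unfolding orthogonal_array_def by simp
  moreover have "restrict_tuple (x(s := a)) S = map x us @ a # map x vs" for a
    using d(1,2) unfolding restrict_tuple_def l by (auto intro!: map_cong)
  ultimately show ?thesis by simp
qed

section \<open>Density of the negative inputs\<close>

context oa_family
begin

definition negatives :: "(nat \<Rightarrow> nat) set" where
  "negatives = {x \<in> inputs n q. \<forall>S \<in> index_sets. \<not> P S x}"

lemma card_inputs: "card (inputs n q) = q ^ n"
  by (simp add: inputs_def card_PiE)

text \<open>Union bound: each \<open>S\<close> rules out a fraction \<open>1/q\<close> of the
  inputs, so at least half of them remain. The quarter is chosen to agree with the case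
  \<open>k = 1\<close>.\<close>

lemma negatives_large_union:
  assumes "2 * real (n choose k) \<le> real q"
  shows "real (card negatives) \<ge> real q ^ n / 4"
proof -
  have "inputs n q - negatives = (\<Union>S\<in>index_sets. {x. x \<in> inputs n q \<and> P S x})"
    unfolding negatives_def by auto
  then have "card (inputs n q - negatives) \<le> (\<Sum>S\<in>index_sets. card {x. x \<in> inputs n q \<and> P S x})"
    using card_UN_le[OF finite_index_sets] by simp
  then have "real (card (inputs n q - negatives)) \<le> (\<Sum>S\<in>index_sets. real (card {x. x \<in> inputs n q \<and> P S x}))"
    by (simp flip: of_nat_sum)
  also have "\<dots> = (\<Sum>S\<in>index_sets. real q ^ n / real q)"
    using card_restrict q1 by (intro sum.cong refl) (simp add: field_simps)
  also have "\<dots> = real (n choose k) / real q * real q ^ n" by (simp add: card_index_sets)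
  also have "\<dots> \<le> 1 / 2 * real q ^ n"
    using assms q1 by (intro mult_right_mono) (simp_all add: field_simps)
  finally have "real (card (inputs n q - negatives)) \<le> real q ^ n / 2" by simp
  moreover have "card (inputs n q - negatives) = q ^ n - card negatives" "card negatives \<le> q ^ n"
    using card_Diff_subset[of negatives "inputs n q"] card_mono[of "inputs n q" negatives] card_inputs
    by (auto simp: negatives_def)
  ultimately show ?thesis
    using zero_le_power[of "real q" n] by (simp add: of_nat_diff)
qed

text \<open>For \<open>k = 1\<close> the union bound is too weak when \<open>q\<close> is close to
  \<open>n\<close>. The conditions then concern different coordinates, each forbidding exactly one
  symbol, so the count is exactly \<open>(q - 1) ^ n\<close>; the density
  \<open>(1 - 1/q) ^ n\<close> is at least \<open>(1 - 1/q) ^ q \<ge> 1/4\<close>.\<close>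

lemma negatives_large_1:
  assumes k: "k = 1" and nq: "2 \<le> n" "n \<le> q" and local: "\<And>i x y. i \<in> {1..n} \<Longrightarrow> x i = y i \<Longrightarrow> P {i} x = P {i} y"
  shows "real (card negatives) \<ge> real q ^ n / 4"
proof -
  \<comment> \<open>As \<open>P {i} x\<close> depends on \<open>x i\<close> alone, a constant
    function may represent all \<open>x\<close> with that symbol at \<open>i\<close>.\<close>
  define B where "B = (\<lambda>i. {a \<in> {1..q}. \<not> P {i} (\<lambda>_. a)})"
  have PB: "P {i} x \<longleftrightarrow> P {i} (\<lambda>_. x i)" if "i \<in> {1..n}" for i x
    by (rule local[OF that]) simp
  have index_sets: "index_sets = (\<lambda>i. {i}) ` {1..n}"
  proof -
    have "index_sets = {S. S \<subseteq> {1..n} \<and> card S = 1}" unfolding index_sets_def by (simp only: k)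
    then show ?thesis by (auto simp: card_1_singleton_iff)
  qed
  have "negatives = PiE {1..n} B"
  proof (rule Set.set_eqI)
    fix x
    have "(\<forall>S\<in>index_sets. \<not> P S x) \<longleftrightarrow> (\<forall>i\<in>{1..n}. \<not> P {i} x)"
      unfolding index_sets by blast
    then have "x \<in> negatives \<longleftrightarrow> x \<in> inputs n q \<and> (\<forall>i\<in>{1..n}. \<not> P {i} (\<lambda>_. x i))"
      unfolding negatives_def using PB[of _ x] by blast
    also have "\<dots> \<longleftrightarrow> x \<in> PiE {1..n} B"
      unfolding inputs_def B_def by (auto simp: PiE_iff)
    finally show "x \<in> negatives \<longleftrightarrow> x \<in> PiE {1..n} B" .
  qed
  moreover have "card (B i) = q - 1" if i: "i \<in> {1..n}" for i
  proof -
    define x where "x = (\<lambda>j\<in>{1..n}. 1::nat)"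
    have "x \<in> inputs n q" unfolding x_def inputs_def using q1 by auto
    then obtain a where a: "{a \<in> {1..q}. P {i} (x(i := a))} = {a}"
      using exactly_one[of "{i}" i x] i k by auto
    have "P {i} (x(i := b)) = P {i} (\<lambda>_. b)" for b
      by (rule local[OF i]) simp
    then have "{a \<in> {1..q}. P {i} (\<lambda>_. a)} = {a}" using a by simp
    then have "B i = {1..q} - {a}" "a \<in> {1..q}" unfolding B_def by blast+
    then show ?thesis by simp
  qed
  ultimately have "card negatives = (q - 1) ^ n" by (simp add: card_PiE)
  then have c: "real (card negatives) = (real q - 1) ^ n" using q1 by (simp add: of_nat_diff)
  have q2: "real q \<ge> 2" using nq by simp
  have "real q ^ n / 4 \<le> (real q - 1) ^ n"
  proof -
    let ?r = "1 - 1 / real q"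
    have r: "?r \<ge> 1 / 2" using q2 by (simp add: field_simps)
    have "1 / 4 \<le> ?r ^ q"
    proof -
      \<comment> \<open>Bernoulli's inequality with the full exponent \<open>q\<close> would give
        only 0, so it is applied with half the exponent and the result is squared.\<close>
      define m where "m = q div 2"
      have m1: "real m \<ge> 1" using nq by (simp add: m_def)
      have "1 + real m * (- 1 / real q) \<le> (1 + (- 1 / real q)) ^ m"
        by (rule Bernoulli_inequality) (use q2 in \<open>simp add: field_simps\<close>)
      then have h: "1 - real m / real q \<le> ?r ^ m" by simp
      show ?thesis
      proof (cases "even q")
        case True
        then have q: "q = m + m" unfolding m_def by presburger
        then have "1 / 2 \<le> ?r ^ m" using h m1 by simp
        then have "1 / 2 * (1 / 2) \<le> ?r ^ m * ?r ^ m" by (intro mult_mono) auto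
        then show ?thesis by (subst (2) q) (simp add: power_add)
      next
        case False
        then have q: "q = m + m + 1" unfolding m_def by presburger
        have qm: "real q = 2 * real m + 1" by (subst q) simp
        \<comment> \<open>For odd \<open>q\<close> one factor \<open>1 - 1/q\<close> is left over;
          after clearing denominators the claim is
          \<open>4 * m\<^sup>2 + 2 * m \<ge> 1\<close>.\<close>
        let ?u = "(real m + 1) / (2 * real m + 1)"
        have "1 / 4 \<le> ?u * ?u * (2 * real m / (2 * real m + 1))"
        proof -
          have "(2 * real m + 1) ^ 3 \<le> 8 * real m * (real m + 1)\<^sup>2"
          proof -
            have "8 * real m * (real m + 1)\<^sup>2 - (2 * real m + 1) ^ 3 = 4 * (real m * real m) + 2 * real m - 1"
              by (simp add: power2_eq_square power3_eq_cube algebra_simps)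
            then show ?thesis using m1 mult_mono[OF m1 m1] by simp
          qed
          then have "1 / 4 \<le> 2 * real m * (real m + 1)\<^sup>2 / (2 * real m + 1) ^ 3"
            using m1 by (simp add: pos_le_divide_eq)
          then show ?thesis by (simp add: power2_eq_square power3_eq_cube mult_ac)
        qed
        also have "\<dots> \<le> ?r ^ m * ?r ^ m * ?r"
        proof (intro mult_mono)
          show "?u \<le> ?r ^ m" using h m1 unfolding qm by (simp add: field_simps)
          then show "?u \<le> ?r ^ m" .
          show "2 * real m / (2 * real m + 1) \<le> ?r" unfolding qm using m1 by (simp add: field_simps)
        qed (use m1 r in auto)
        also have "\<dots> = ?r ^ q" by (subst (4) q) (simp add: power_add)
        finally show ?thesis .
      qed
    qed
    also have "\<dots> \<le> ?r ^ n" using nq r q2 by (intro power_decreasing) (auto simp: field_simps)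
    finally have "1 / 4 * real q ^ n \<le> ?r ^ n * real q ^ n" by (intro mult_right_mono) auto
    also have "\<dots> = (real q - 1) ^ n" using q2 by (simp add: power_mult_distrib[symmetric] field_simps)
    finally show ?thesis by simp
  qed
  then show ?thesis using c by simp
qed

end

lemma query_lower_bound:
  fixes k n q :: nat
  assumes k: "1 \<le> k" and n: "k + 1 \<le> n" and q: "n ^ k \<le> q"
    and T: "\<forall>S \<subseteq> {1..n}. card S = k \<longrightarrow> orthogonal_array k q (T S)"
    and comp: "computable_with_queries n q (orthogonal_array_problem n k T) s"
  shows "real n powr (real k / real (k + 1)) \<le> 200 * sqrt (real k * (1 + real k ^ k)) * real s"
proof -
  define t where "t = real n powr (real k / real (k + 1))"
  define P where "P = (\<lambda>S x. restrict_tuple x S \<in> T S)"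
  have n0: "0 < n" using n by simp
  have "1 \<le> n ^ k" using n0 by simp
  then have q1: "1 \<le> q" using q by linarith
  interpret oa_family n q k P t
  proof
    have "t > 0" using n0 by (simp add: t_def)
    then have "t ^ (k + 1) = t powr real (k + 1)" by (simp only: powr_realpow)
    also have "\<dots> = real n powr (real k / real (k + 1) * real (k + 1))"
      unfolding t_def by (rule powr_powr)
    also have "real k / real (k + 1) * real (k + 1) = real k" by simp
    also have "real n powr real k = real n ^ k" using n0 by (simp add: powr_realpow)
    finally show "t ^ (k + 1) = real n ^ k" .
    show "\<exists>!a. a \<in> {1..q} \<and> P S (x(s := a))"
      if "S \<subseteq> {1..n}" "card S = k" "s \<in> S" "x \<in> inputs n q" for S s x
      unfolding P_def by (rule orthogonal_array_exactly_one) (use T that in auto)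
  qed (use k n q1 in \<open>auto simp: t_def\<close>)
  have card: "real (card negatives) \<ge> real q ^ n / 4"
  proof (cases "k = 1")
    case True
    show ?thesis
    proof (rule negatives_large_1[OF True])
      show "P {i} x = P {i} y" if "x i = y i" for i x y
        unfolding P_def restrict_tuple_def using that by simp
      \<comment> \<open>The threshold \<open>k + 1\<close> for \<open>n\<close> matters here: for
        \<open>n = q = k = 1\<close> there is no negative input.\<close>
      show "2 \<le> n" using True n by simp
      show "n \<le> q" using True q by simp
    qed
  next
    case False
    \<comment> \<open>For \<open>k \<ge> 2\<close> the union bound suffices, since
      \<open>(n choose k) * k! \<le> n ^ k \<le> q\<close> and \<open>k! \<ge> 2\<close>.\<close>
    then have "fact 2 \<le> (fact k :: nat)" using k by (intro fact_mono) auto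
    then have "2 * (n choose k) \<le> (n choose k) * fact k" by simp
    also have "\<dots> \<le> q" using binomial_fact_pow[of n k] q by linarith
    finally have "real (2 * (n choose k)) \<le> real q" unfolding of_nat_le_iff .
    then show ?thesis by (intro negatives_large_union) simp
  qed
  have Y: "negatives \<subseteq> inputs n q" by (auto simp: negatives_def)
  obtain f g where fg: "L2_set (\<lambda>r. cmod (f r)) rows \<le> 1" "L2_set (\<lambda>y. cmod (g y)) negatives \<le> 1"
    "cmod (form rows negatives adv_matrix f g) \<ge> t / 2"
    using adv_matrix_large[OF Y card] by blast
  \<comment> \<open>The 50 comes from the adversary bound and the 2 before the root from masking the
    entries; with the halved \<open>t\<close> they make up the constant 200.\<close>
  have "t / 2 \<le> 50 * real s * (2 * sqrt (real k * (1 + real k ^ k)))"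
  proof (rule adversary_bound[OF n0 _ finite_rows _ _ _ adv_matrix_differ_bounded[OF Y] _ fg comp])
    show "snd r \<in> inputs n q \<and> orthogonal_array_problem n k T (snd r) = 1" if "r \<in> rows" for r
    proof -
      have "snd r \<in> inputs n q" "fst r \<in> index_sets" "P (fst r) (snd r)"
        using that by (auto simp: rows_def)
      then show ?thesis unfolding index_sets_def P_def orthogonal_array_problem_def by auto
    qed
    show "y \<in> inputs n q \<and> orthogonal_array_problem n k T y = 0" if "y \<in> negatives" for y
    proof -
      have "y \<in> inputs n q" "\<forall>S\<in>index_sets. \<not> P S y"
        using that by (auto simp: negatives_def)
      then show ?thesis unfolding index_sets_def P_def orthogonal_array_problem_def by auto
    qed
  qed (use q1 finite_subset[OF Y] in auto)
  then show ?thesis unfolding t_def[symmetric] by (simp add: mult_ac)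
qed

theorem theorem5:
  fixes k :: nat
  assumes "k \<ge> 1"
  shows "\<exists>c::real. c > 0 \<and> (\<exists>n\<^sub>0::nat. \<forall>n \<ge> n\<^sub>0. \<forall>q \<ge> n ^ k. \<forall>T :: nat set \<Rightarrow> nat list set.
           (\<forall>S \<subseteq> {1..n}. card S = k \<longrightarrow> orthogonal_array k q (T S)) \<longrightarrow>
           ereal_of_enat (Q2 n q (orthogonal_array_problem n k T))
             \<ge> ereal (c * real n powr (real k / real (k + 1))))"
proof -
  define d where "d = 200 * sqrt (real k * (1 + real k ^ k))"
  have d: "d > 0" using assms unfolding d_def by (simp add: add_pos_nonneg)
  show ?thesis
  proof (intro exI[of _ "1 / d"] exI[of _ "k + 1"] conjI allI impI)
    fix n q :: nat and T :: "nat set \<Rightarrow> nat list set"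
    assume n: "k + 1 \<le> n" and q: "n ^ k \<le> q"
      and T: "\<forall>S \<subseteq> {1..n}. card S = k \<longrightarrow> orthogonal_array k q (T S)"
    let ?f = "orthogonal_array_problem n k T"
    show "ereal (1 / d * real n powr (real k / real (k + 1))) \<le> ereal_of_enat (Q2 n q ?f)"
    proof (cases "Q2 n q ?f")
      case (enat s)
      let ?S = "{enat t | t. computable_with_queries n q ?f t}"
      \<comment> \<open>The infimum of the empty set is infinite, so a finite value is attained as a
        least element.\<close>
      have "?S \<noteq> {}" using enat unfolding Q2_def Inf_enat_def by (auto split: if_splits)
      then obtain e where "e \<in> ?S" by blast
      then have "(LEAST e. e \<in> ?S) \<in> ?S" by (rule LeastI)
      then have "Q2 n q ?f \<in> ?S" unfolding Q2_def Inf_enat_def using \<open>?S \<noteq> {}\<close> by (simp only: if_False)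
      then have "computable_with_queries n q ?f s" using enat by auto
      then have "real n powr (real k / real (k + 1)) \<le> d * real s"
        unfolding d_def by (rule query_lower_bound[OF assms n q T])
      then have "1 / d * real n powr (real k / real (k + 1)) \<le> real s"
        using d by (simp add: field_simps)
      then show ?thesis using enat by simp
    qed simp
  qed (use d in simp)
qed

end
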